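(* Let $f:\mathbb{C}\to\mathbb{C}$ be a transcendental entire function and let $0<\varepsilon<1$. Then: (a) $f$ is $\varepsilon$-regular if and only if $Q_\varepsilon(f)=A(f)$; (b) $f$ is weakly regular if and only if $Q(f)=A(f)$.
   Context: Here $\mathbb{N}=\{1,2,\dots\}$ and $f^n$ denotes the $n$th iterate of $f$. Put $M(r)=M(r,f)=\max_{|z|=r}|f(z)|$ for $r>0$, and let $M^n(r)$ denote the $n$th iterate of the function $M$. For $0<\varepsilon<1$ put $\mu_\varepsilon(r)=M(r)^\varepsilon$, $r>0$, with iterates $\mu_\varepsilon^n$. The fast escaping set is $$A(f)=\{z\in\mathbb{C}:\text{there exists }\ell\in\mathbb{N}\text{ such that }|f^{n+\ell}(z)|\ge M^n(R)\text{ for all }n\in\mathbb{N}\},$$ where $R>0$ is any value such that $M(r)>r$ for $r\ge R$. For $0<\varepsilon<1$, $$Q_\varepsilon(f)=\{z\in\mathbb{C}:\text{there exists }\ell\in\mathbb{N}\text{ such that }|f^{n+\ell}(z)|\ge \mu_\varepsilon^n(R)\text{ for all }n\in\mathbb{N}\},$$ where $R>0$ is any value such that $\mu_\varepsilon(r)>r$ for $r\ge R$. These definitions do not depend on the choice of such $R$. The quite fast escaping set is $Q(f)=\bigcup_{0<\varepsilon<1}Q_\varepsilon(f)$. Let $R>0$ be any value such that $M(r)>r$ for $r\ge R$. The function $f$ is $\varepsilon$-regular ($0<\varepsilon<1$) if there exists $r=r(R)>0$ such that $\mu_\varepsilon^n(r)\ge M^n(R)$ for all $n\in\mathbb{N}$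 (this does not depend on the choice of such $R$). The function $f$ is weakly regular if it is $\varepsilon$-regular for every $\varepsilon\in(0,1)$. *)

theory Defs
  imports "HOL-Complex_Analysis.Complex_Analysis"
begin

definition transcendental_entire :: "(complex \<Rightarrow> complex) \<Rightarrow> bool" where
  "transcendental_entire f \<longleftrightarrow> f holomorphic_on UNIV \<and> (\<nexists>p. f = poly p)"

(* For continuous f and r > 0 the supremum is an attained maximum: see max_modulus_attained. *)
definition max_modulus :: "(complex \<Rightarrow> complex) \<Rightarrow> real \<Rightarrow> real" where
  "max_modulus f r = (SUP z\<in>sphere 0 r. norm (f z))"

definition mu :: "real \<Rightarrow> (complex \<Rightarrow> complex) \<Rightarrow> real \<Rightarrow> real" where
  "mu \<epsilon> f r = max_modulus f r powr \<epsilon>"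

definition admissible :: "(real \<Rightarrow> real) \<Rightarrow> real \<Rightarrow> bool" where
  "admissible g R \<longleftrightarrow> R > 0 \<and> (\<forall>r\<ge>R. g r > r)"

(* The definitions below ask for the condition at some admissible R. For transcendental entire f
   admissible values exist, and the condition does not depend on which one is taken: see
   ex_admissible_max_modulus, ex_admissible_mu, fast_escaping_eq, quite_fast_escaping_eps_eq and
   eps_regular_iff at the end of this theory. The bounds l \<ge> 1, n \<ge> 1 reflect that the natural
   numbers start at 1. *)

definition fast_escaping :: "(complex \<Rightarrow> complex) \<Rightarrow> complex set" where
  "fast_escaping f = {z. \<exists>R. admissible (max_modulus f) R \<and>
     (\<exists>l\<ge>1. \<forall>n\<ge>1. norm ((f ^^ (n + l)) z) \<ge> (max_modulus f ^^ n) R)}"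

definition quite_fast_escaping_eps :: "real \<Rightarrow> (complex \<Rightarrow> complex) \<Rightarrow> complex set" where
  "quite_fast_escaping_eps \<epsilon> f = {z. \<exists>R. admissible (mu \<epsilon> f) R \<and>
     (\<exists>l\<ge>1. \<forall>n\<ge>1. norm ((f ^^ (n + l)) z) \<ge> (mu \<epsilon> f ^^ n) R)}"

definition quite_fast_escaping :: "(complex \<Rightarrow> complex) \<Rightarrow> complex set" where
  "quite_fast_escaping f = (\<Union>\<epsilon>\<in>{0<..<1}. quite_fast_escaping_eps \<epsilon> f)"

definition eps_regular :: "real \<Rightarrow> (complex \<Rightarrow> complex) \<Rightarrow> bool" where
  "eps_regular \<epsilon> f \<longleftrightarrow> (\<exists>R. admissible (max_modulus f) R \<and>
     (\<exists>r>0. \<forall>n\<ge>1. (mu \<epsilon> f ^^ n) r \<ge> (max_modulus f ^^ n) R))"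

definition weakly_regular :: "(complex \<Rightarrow> complex) \<Rightarrow> bool" where
  "weakly_regular f \<longleftrightarrow> (\<forall>\<epsilon>\<in>{0<..<1}. eps_regular \<epsilon> f)"


lemma max_modulus_attained:
  assumes "continuous_on UNIV f" "r > 0"
  obtains z where "norm z = r" "max_modulus f r = norm (f z)"
    "\<And>w. norm w = r \<Longrightarrow> norm (f w) \<le> norm (f z)"
proof -
  have ne: "sphere (0::complex) r \<noteq> {}"
    using assms(2) by simp
  have c: "continuous_on (sphere 0 r) (\<lambda>z. norm (f z))"
    using assms(1) by (intro continuous_on_norm) (auto intro: continuous_on_subset)
  obtain z where z: "z \<in> sphere 0 r" "\<forall>w\<in>sphere 0 r. norm (f w) \<le> norm (f z)"
    using continuous_attains_sup[OF compact_sphere ne c] by blast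
  have "max_modulus f r = norm (f z)"
    unfolding max_modulus_def by (rule cSup_eq_maximum) (use z in auto)
  then show ?thesis
    using that z by auto
qed

lemma entire_cont: "f holomorphic_on UNIV \<Longrightarrow> continuous_on UNIV f"
  by (rule holomorphic_on_imp_continuous_on)

lemma norm_le_max_modulus:
  assumes "f holomorphic_on UNIV" "norm z \<le> r" "r > 0"
  shows "norm (f z) \<le> max_modulus f r"
proof (rule maximum_modulus_frontier[where f = f and S = "cball 0 r" and \<xi> = z])
  show "f holomorphic_on interior (cball 0 r)"
    using assms(1) holomorphic_on_subset by blast
  show "continuous_on (closure (cball 0 r)) f"
    using entire_cont[OF assms(1)] continuous_on_subset by blast
  show "norm (f w) \<le> max_modulus f r" if "w \<in> frontier (cball 0 r)" for w
  proof (rule max_modulus_attained[OF entire_cont[OF assms(1)] assms(3)])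
    fix u assume u: "max_modulus f r = norm (f u)"
      "\<And>w. norm w = r \<Longrightarrow> norm (f w) \<le> norm (f u)"
    have "norm w = r"
      using that assms(3) by simp
    then show ?thesis
      using u by simp
  qed
qed (use assms in auto)

lemma max_modulus_nonneg:
  assumes "f holomorphic_on UNIV" "r > 0"
  shows "max_modulus f r \<ge> 0"
  by (rule order_trans[OF norm_ge_zero[of "f 0"] norm_le_max_modulus[OF assms(1)]])
    (use assms(2) in auto)

lemma max_modulus_mono:
  assumes "f holomorphic_on UNIV" "0 < r" "r \<le> s"
  shows "max_modulus f r \<le> max_modulus f s"
proof (rule max_modulus_attained[OF entire_cont[OF assms(1)] assms(2)])
  fix z assume "norm z = r" "max_modulus f r = norm (f z)"
  then show ?thesis
    using norm_le_max_modulus[OF assms(1), of z s] assms(2,3) by simp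
qed

lemma max_modulus_lsc:
  assumes "f holomorphic_on UNIV" "0 < L" "c < max_modulus f L"
  shows "\<exists>s. 0 < s \<and> s < L \<and> c < max_modulus f s"
proof -
  obtain z where z: "norm z = L" "max_modulus f L = norm (f z)"
    by (rule max_modulus_attained[OF entire_cont[OF assms(1)] assms(2)])
  have cont: "isCont f z"
    using entire_cont[OF assms(1)] by (simp add: continuous_on_eq_continuous_at)
  have "((\<lambda>t::real. of_real t * z) \<longlongrightarrow> of_real 1 * z) (at_left 1)"
    by (intro tendsto_intros)
  then have lim: "((\<lambda>t::real. of_real t * z) \<longlongrightarrow> z) (at_left 1)"
    by simp
  have "((\<lambda>t::real. f (of_real t * z)) \<longlongrightarrow> f z) (at_left 1)"
    by (rule isCont_tendsto_compose[OF cont lim])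
  then have "((\<lambda>t::real. norm (f (of_real t * z))) \<longlongrightarrow> norm (f z)) (at_left 1)"
    by (rule tendsto_norm)
  then have "\<forall>\<^sub>F t in at_left (1::real). c < norm (f (of_real t * z))"
    by (rule order_tendstoD(1)) (use assms(3) z(2) in simp)
  moreover have "\<forall>\<^sub>F t in at_left (1::real). t \<in> {0<..<1}"
    by (rule eventually_at_left_real) simp
  ultimately have "\<forall>\<^sub>F t in at_left (1::real). c < norm (f (of_real t * z)) \<and> t \<in> {0<..<1}"
    by (rule eventually_conj)
  then obtain t :: real where t: "c < norm (f (of_real t * z))" "0 < t" "t < 1"
    using eventually_happens'[of "at_left (1::real)"] by (auto simp: trivial_limit_at_left_real)
  have tL: "0 < t * L" "t * L < L"
    using t assms(2) by auto
  have "norm (f (of_real t * z)) \<le> max_modulus f (t * L)"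
    using t z(1) tL by (intro norm_le_max_modulus[OF assms(1)]) (auto simp: norm_mult)
  then show ?thesis
    using t(1) tL by (intro exI[of _ "t * L"]) auto
qed

lemma mu_mono:
  assumes "f holomorphic_on UNIV" "0 < \<epsilon>" "0 < r" "r \<le> s"
  shows "mu \<epsilon> f r \<le> mu \<epsilon> f s"
  unfolding mu_def using assms max_modulus_nonneg max_modulus_mono
  by (intro powr_mono2) auto

lemma mu_lsc:
  assumes "f holomorphic_on UNIV" "0 < \<epsilon>" "0 < L" "L < mu \<epsilon> f L"
  shows "\<exists>s. 0 < s \<and> s < L \<and> L < mu \<epsilon> f s"
proof -
  have M: "max_modulus f L \<ge> 0"
    using assms max_modulus_nonneg by blast
  have "L powr (1/\<epsilon>) < (max_modulus f L powr \<epsilon>) powr (1/\<epsilon>)"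
    using assms unfolding mu_def by (intro powr_less_mono2) auto
  then have "L powr (1/\<epsilon>) < max_modulus f L"
    using M assms(2) by (simp add: powr_powr)
  then obtain s where s: "0 < s" "s < L" "L powr (1/\<epsilon>) < max_modulus f s"
    using max_modulus_lsc[OF assms(1,3)] by blast
  have "(L powr (1/\<epsilon>)) powr \<epsilon> < max_modulus f s powr \<epsilon>"
    using s assms(2) by (intro powr_less_mono2) auto
  then show ?thesis
    using s assms(2,3) unfolding mu_def by (auto simp: powr_powr)
qed

lemma admissible_iter:
  assumes "admissible g R"
  shows "R \<le> (g ^^ n) R"
proof (induction n)
  case (Suc n)
  then have "(g ^^ n) R < (g ^^ Suc n) R"
    using assms by (simp add: admissible_def)
  with Suc show ?case
    by linarith
qed simp

lemma iter_reaches: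
  assumes adm: "admissible g R"
    and mono: "\<And>r s. 0 < r \<Longrightarrow> r \<le> s \<Longrightarrow> g r \<le> g s"
    and lsc: "\<And>L. 0 < L \<Longrightarrow> L < g L \<Longrightarrow> \<exists>s. 0 < s \<and> s < L \<and> L < g s"
  shows "\<exists>m. S \<le> (g ^^ m) R"
proof (rule ccontr)
  assume "\<not> ?thesis"
  then have lt: "(g ^^ m) R < S" for m
    by (meson not_less)
  define L where "L = (SUP m. (g ^^ m) R)"
  have bdd: "bdd_above (range (\<lambda>m. (g ^^ m) R))"
    using lt by (intro bdd_aboveI[of _ S]) (auto intro: less_imp_le)
  have le: "(g ^^ m) R \<le> L" for m
    unfolding L_def using bdd by (rule cSUP_upper[rotated]) simp
  have "R \<le> L" "0 < R"
    using le[of 0] adm by (auto simp: admissible_def)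
  then have "L < g L" "0 < L"
    using adm by (auto simp: admissible_def)
  then obtain s where s: "0 < s" "s < L" "L < g s"
    using lsc by blast
  obtain m where "s < (g ^^ m) R"
    using s(2) bdd unfolding L_def by (auto simp: less_cSUP_iff)
  then have "g s \<le> (g ^^ Suc m) R"
    using mono s(1) by simp
  then show False
    using le[of "Suc m"] s(3) by linarith
qed

lemma iter_mono:
  fixes g :: "real \<Rightarrow> real"
  assumes "admissible g R" "R \<le> S"
    and mono: "\<And>r s. 0 < r \<Longrightarrow> r \<le> s \<Longrightarrow> g r \<le> g s"
  shows "(g ^^ n) R \<le> (g ^^ n) S"
proof (induction n)
  case (Suc n)
  have "0 < (g ^^ n) R"
    using admissible_iter[OF assms(1), of n] assms(1) by (auto simp: admissible_def)
  then show ?case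
    using mono Suc by simp
qed (use assms in simp)

lemma escaping_indep:
  assumes "admissible g R" "admissible g S"
    and mono: "\<And>r s. 0 < r \<Longrightarrow> r \<le> s \<Longrightarrow> g r \<le> g s"
    and lsc: "\<And>L. 0 < L \<Longrightarrow> L < g L \<Longrightarrow> \<exists>s. 0 < s \<and> s < L \<and> L < g s"
    and "\<exists>l\<ge>1. \<forall>n\<ge>1. norm ((f ^^ (n + l)) z) \<ge> (g ^^ n) R"
  shows "\<exists>l\<ge>1. \<forall>n\<ge>1. norm ((f ^^ (n + l)) z) \<ge> (g ^^ n) S"
proof -
  obtain l where l: "l \<ge> 1" "\<And>n. n \<ge> 1 \<Longrightarrow> norm ((f ^^ (n + l)) z) \<ge> (g ^^ n) R"
    using assms(5) by blast
  obtain m where m: "S \<le> (g ^^ m) R"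
    using iter_reaches[OF assms(1) mono lsc] by blast
  have "(g ^^ n) S \<le> norm ((f ^^ (n + (m + l))) z)" if "n \<ge> 1" for n
  proof -
    have "(g ^^ n) S \<le> (g ^^ n) ((g ^^ m) R)"
      by (rule iter_mono[OF assms(2) m mono])
    also have "\<dots> = (g ^^ (n + m)) R"
      by (simp add: funpow_add)
    also have "\<dots> \<le> norm ((f ^^ (n + m + l)) z)"
      using l(2)[of "n + m"] that by simp
    finally show ?thesis
      by (simp add: add.assoc)
  qed
  then show ?thesis
    using l(1) by (intro exI[of _ "m + l"]) auto
qed

theorem fast_escaping_eq:
  assumes "f holomorphic_on UNIV" "admissible (max_modulus f) R"
  shows "fast_escaping f =
    {z. \<exists>l\<ge>1. \<forall>n\<ge>1. norm ((f ^^ (n + l)) z) \<ge> (max_modulus f ^^ n) R}"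
  unfolding fast_escaping_def
proof (rule Collect_cong, rule iffI)
  fix z
  assume "\<exists>R. admissible (max_modulus f) R \<and>
    (\<exists>l\<ge>1. \<forall>n\<ge>1. norm ((f ^^ (n + l)) z) \<ge> (max_modulus f ^^ n) R)"
  then obtain R' where "admissible (max_modulus f) R'"
    and "\<exists>l\<ge>1. \<forall>n\<ge>1. norm ((f ^^ (n + l)) z) \<ge> (max_modulus f ^^ n) R'"
    by blast
  then show "\<exists>l\<ge>1. \<forall>n\<ge>1. norm ((f ^^ (n + l)) z) \<ge> (max_modulus f ^^ n) R"
    using escaping_indep[of "max_modulus f" R' R f z] assms max_modulus_mono max_modulus_lsc by presburger
qed (use assms(2) in blast)

theorem quite_fast_escaping_eps_eq:
  assumes "f holomorphic_on UNIV" "0 < \<epsilon>" "admissible (mu \<epsilon> f) R"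
  shows "quite_fast_escaping_eps \<epsilon> f =
    {z. \<exists>l\<ge>1. \<forall>n\<ge>1. norm ((f ^^ (n + l)) z) \<ge> (mu \<epsilon> f ^^ n) R}"
  unfolding quite_fast_escaping_eps_def
proof (rule Collect_cong, rule iffI)
  fix z
  assume "\<exists>R. admissible (mu \<epsilon> f) R \<and>
    (\<exists>l\<ge>1. \<forall>n\<ge>1. norm ((f ^^ (n + l)) z) \<ge> (mu \<epsilon> f ^^ n) R)"
  then obtain R' where "admissible (mu \<epsilon> f) R'"
    and "\<exists>l\<ge>1. \<forall>n\<ge>1. norm ((f ^^ (n + l)) z) \<ge> (mu \<epsilon> f ^^ n) R'"
    by blast
  then show "\<exists>l\<ge>1. \<forall>n\<ge>1. norm ((f ^^ (n + l)) z) \<ge> (mu \<epsilon> f ^^ n) R"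
    using escaping_indep[of "mu \<epsilon> f" R' R f z] assms mu_mono mu_lsc by presburger
qed (use assms(3) in blast)

theorem eps_regular_iff:
  assumes "f holomorphic_on UNIV" "admissible (max_modulus f) R"
  shows "eps_regular \<epsilon> f \<longleftrightarrow> (\<exists>r>0. \<forall>n\<ge>1. (mu \<epsilon> f ^^ n) r \<ge> (max_modulus f ^^ n) R)"
proof
  assume "eps_regular \<epsilon> f"
  then obtain R' r where R': "admissible (max_modulus f) R'" and "r > 0"
    and r: "\<And>n. n \<ge> 1 \<Longrightarrow> (mu \<epsilon> f ^^ n) r \<ge> (max_modulus f ^^ n) R'"
    unfolding eps_regular_def by blast
  obtain m where m: "R \<le> (max_modulus f ^^ m) R'"
    using iter_reaches[OF R' max_modulus_mono[OF assms(1)] max_modulus_lsc[OF assms(1)]] by blast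
  define r' where "r' = (mu \<epsilon> f ^^ m) r"
  have "r' > 0"
  proof (cases "m = 0")
    case False
    then show ?thesis
      using r[of m] m assms(2) by (auto simp: r'_def admissible_def)
  qed (use \<open>r > 0\<close> in \<open>simp add: r'_def\<close>)
  moreover have "(max_modulus f ^^ n) R \<le> (mu \<epsilon> f ^^ n) r'" if "n \<ge> 1" for n
  proof -
    have "(max_modulus f ^^ n) R \<le> (max_modulus f ^^ n) ((max_modulus f ^^ m) R')"
      by (rule iter_mono[OF assms(2) m max_modulus_mono[OF assms(1)]])
    also have "\<dots> = (max_modulus f ^^ (n + m)) R'"
      by (simp add: funpow_add)
    also have "\<dots> \<le> (mu \<epsilon> f ^^ (n + m)) r"
      using r[of "n + m"] that by simp
    finally show ?thesis
      by (simp add: r'_def funpow_add)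
  qed
  ultimately show "\<exists>r>0. \<forall>n\<ge>1. (mu \<epsilon> f ^^ n) r \<ge> (max_modulus f ^^ n) R"
    by blast
qed (use assms(2) in \<open>auto simp: eps_regular_def\<close>)

lemma max_modulus_superpolynomial:
  assumes "transcendental_entire f"
  shows "\<exists>R>0. \<forall>r\<ge>R. max_modulus f r > r ^ k"
proof (rule ccontr)
  assume neg: "\<not> ?thesis"
  have hol: "f holomorphic_on UNIV"
    using assms by (simp add: transcendental_entire_def)
  have zero: "(deriv ^^ n) f 0 = 0" if "n > k" for n
  proof (rule ccontr)
    assume nz: "(deriv ^^ n) f 0 \<noteq> 0"
    define R where "R = fact n / norm ((deriv ^^ n) f 0) + 1"
    have "R \<ge> 1"
      by (simp add: R_def)
    then obtain r where r: "r \<ge> R" "max_modulus f r \<le> r ^ k"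
      using neg by (meson not_less less_le_trans zero_less_one)
    have r1: "r \<ge> 1"
      using r \<open>R \<ge> 1\<close> by linarith
    have "norm ((deriv ^^ n) f 0) \<le> fact n * r ^ k / r ^ n"
    proof (rule Cauchy_inequality)
      show "f holomorphic_on ball 0 r"
        using hol holomorphic_on_subset by blast
      show "continuous_on (cball 0 r) f"
        using entire_cont[OF hol] continuous_on_subset by blast
      show "norm (f x) \<le> r ^ k" if "norm (0 - x) = r" for x
        using that norm_le_max_modulus[OF hol, of x r] r r1 by simp
    qed (use r1 in simp)
    also have "r ^ n = r ^ k * r ^ (n - k)"
      using that by (simp flip: power_add)
    also have "fact n * r ^ k / (r ^ k * r ^ (n - k)) = fact n / r ^ (n - k)"
      using r1 by simp
    also have "\<dots> \<le> fact n / r"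
      using r1 that by (intro divide_left_mono self_le_power) auto
    finally have "r \<le> fact n / norm ((deriv ^^ n) f 0)"
      using nz r1 by (simp add: field_simps)
    then show False
      using r(1) by (simp add: R_def)
  qed
  have "f z = poly (\<Sum>n\<le>k. monom ((deriv ^^ n) f 0 / fact n) n) z" for z
  proof -
    have "(\<lambda>n. (deriv ^^ n) f 0 / fact n * (z - 0) ^ n) sums f z"
      by (rule holomorphic_power_series[where r = "norm z + 1"])
        (use hol holomorphic_on_subset in auto)
    moreover have "(\<lambda>n. (deriv ^^ n) f 0 / fact n * (z - 0) ^ n) sums
        (\<Sum>n\<le>k. (deriv ^^ n) f 0 / fact n * (z - 0) ^ n)"
      by (rule sums_finite) (use zero in auto)
    ultimately have "f z = (\<Sum>n\<le>k. (deriv ^^ n) f 0 / fact n * (z - 0) ^ n)"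
      by (rule sums_unique2)
    then show ?thesis
      by (simp add: poly_sum poly_monom)
  qed
  then show False
    using assms unfolding transcendental_entire_def by blast
qed

theorem ex_admissible_max_modulus:
  assumes "transcendental_entire f"
  shows "\<exists>R. admissible (max_modulus f) R"
  using max_modulus_superpolynomial[OF assms, of 1] by (auto simp: admissible_def)

theorem ex_admissible_mu:
  assumes "transcendental_entire f" "0 < \<epsilon>"
  shows "\<exists>R. admissible (mu \<epsilon> f) R"
proof -
  define k where "k = nat \<lceil>1 / \<epsilon>\<rceil>"
  have k: "1 / \<epsilon> \<le> real k"
    unfolding k_def by (rule real_nat_ceiling_ge)
  obtain R where R: "R > 0" "\<And>r. r \<ge> R \<Longrightarrow> max_modulus f r > r ^ k"
    using max_modulus_superpolynomial[OF assms(1)] by blast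
  have "r < mu \<epsilon> f r" if "r \<ge> max R 1" for r
  proof -
    have r: "r \<ge> 1" "r \<ge> R"
      using that by auto
    have "r = (r powr (1/\<epsilon>)) powr \<epsilon>"
      using r assms(2) by (simp add: powr_powr)
    also have "\<dots> \<le> (r powr real k) powr \<epsilon>"
      using r k assms(2) by (intro powr_mono2 powr_mono) auto
    also have "\<dots> = (r ^ k) powr \<epsilon>"
      using r by (simp add: powr_realpow)
    also have "\<dots> < mu \<epsilon> f r"
      unfolding mu_def using R(2)[OF r(2)] r assms(2) by (intro powr_less_mono2) auto
    finally show ?thesis .
  qed
  then show ?thesis
    by (intro exI[of _ "max R 1"]) (auto simp: admissible_def)
qed

end

(* The one hard implication is: if f is not eps-regular, some point of Q_eps(f) lies outside A(f).
   Write M for the maximum modulus function and a_n = mu_eps^n(R). Call u low if a forward iterate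
   of u lies in the closed unit disc. If u is low and N is large, f^N is small at u but at least
   M^N(|u|/4) somewhere on |z| = |u|, so by Schottky's theorem the image under f^N of a fixed
   logarithmic neighbourhood of |z| = |u| omits no two separated values of modulus well below
   M^N(|u|/4): it covers one of any two separated round annuli of this kind. Schottky's theorem also
   shows that every large low point v has a much smaller low point u with |v| <= M(M(|u|)).
   Hence one can travel for N steps from the annulus around one low point to the annulus around
   another one, of modulus S with M^(N-p)(|u|) <= S <= M^(N-1)(|u|) for an absolute p. Each such trip
   loses at least one iterate of M, so an orbit following infinitely many of them is not fast
   escaping. It loses only boundedly many iterates per trip, and when f is not eps-regular a trip
   that is long enough regains them relative to a_n, so the orbit stays above a_n. *)

theory Submission
  imports Defs
begin

section \<open>Consequences of Schottky's theorem\<close>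

(* Schottky's bound for a centre value of modulus at most 2 and the disc of radius 1/2. *)
definition Schottky_bound :: real where
  "Schottky_bound = exp (pi * exp (pi * 18))"

lemma Schottky_bound_ge_1: "1 \<le> Schottky_bound"
  unfolding Schottky_bound_def by simp

text \<open>The affine map taking \<open>w1\<close> to 0 and \<open>w2\<close> to 1 reduces this to
  Schottky's theorem with centre bound 2 and \<open>t = 1/2\<close>; the inner exponent is then 2 +
  4 + 12 = 18.\<close>

lemma Schottky_two_values:
  assumes hol: "g holomorphic_on cball 0 1"
    and omit: "w1 \<notin> g ` cball 0 1" "w2 \<notin> g ` cball 0 1"
    and "w1 \<noteq> w2" and centre: "norm (g 0 - w1) \<le> 2 * norm (w2 - w1)"
    and z: "norm z \<le> 1/2"
  shows "norm (g z - w1) \<le> Schottky_bound * norm (w2 - w1)"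
proof -
  have pos: "norm (w2 - w1) > 0"
    using \<open>w1 \<noteq> w2\<close> by simp
  define h where "h = (\<lambda>z. (g z - w1) / (w2 - w1))"
  have "norm (h z) \<le> exp (pi * exp (pi * (2 + 2 * 2 + 12 * (1/2) / (1 - 1/2))))"
  proof (rule Schottky[where f = h and z = z and r = 2 and t = "1/2"])
    show "h holomorphic_on cball 0 1"
      unfolding h_def using \<open>w1 \<noteq> w2\<close> by (intro holomorphic_intros hol) auto
    show "norm (h 0) \<le> 2"
      using centre pos by (simp add: h_def norm_divide field_simps)
    show "\<not> (h z = 0 \<or> h z = 1)" if "z \<in> cball 0 1" for z
      using omit that \<open>w1 \<noteq> w2\<close> by (auto simp: h_def)
  qed (use z in auto)
  then show ?thesis
    using pos by (simp add: h_def norm_divide field_simps Schottky_bound_def)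
qed

definition covering_const :: real where
  "covering_const = 1 + 2 * Schottky_bound"

lemma covering_const_ge_3: "3 \<le> covering_const"
  unfolding covering_const_def using Schottky_bound_ge_1 by simp

text \<open>If both values were omitted, Schottky's bound would apply, since |g 0 - w1| <= 2 |w1| <=
  2 |w2 - w1|. As |w2 - w1| <= 3/2 |w2|, it would keep |g z| below
  \<open>covering_const * norm w2\<close>.\<close>

lemma attains_one_of_two_values:
  assumes hol: "g holomorphic_on cball 0 1"
    and w: "w1 \<noteq> 0" "2 * norm w1 \<le> norm w2" and centre: "norm (g 0) \<le> norm w1"
    and z: "norm z \<le> 1/2" "covering_const * norm w2 < norm (g z)"
  shows "w1 \<in> g ` cball 0 1 \<or> w2 \<in> g ` cball 0 1"
proof (rule ccontr)
  assume neg: "\<not> ?thesis"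
  have d: "norm w1 \<le> norm (w2 - w1)"
    using w norm_triangle_ineq2[of w2 w1] by linarith
  have d': "norm (w2 - w1) \<le> 3/2 * norm w2"
    using w norm_triangle_ineq4[of w2 w1] by linarith
  have "w1 \<noteq> w2"
    using w by auto
  moreover have "norm (g 0 - w1) \<le> 2 * norm (w2 - w1)"
    using centre d norm_triangle_ineq4[of "g 0" w1] by linarith
  ultimately have "norm (g z - w1) \<le> Schottky_bound * norm (w2 - w1)"
    using neg Schottky_two_values[OF hol] z(1) by blast
  also have "\<dots> \<le> Schottky_bound * (3/2 * norm w2)"
    using d' Schottky_bound_ge_1 by (intro mult_left_mono) auto
  finally have "norm (g z) \<le> norm w1 + Schottky_bound * (3/2 * norm w2)"
    using norm_triangle_ineq2[of "g z" w1] by linarith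
  also have "\<dots> \<le> norm w2 + 2 * (Schottky_bound * norm w2)"
    proof -
    have "0 \<le> Schottky_bound * norm w2"
      using Schottky_bound_ge_1 by simp
    moreover have "Schottky_bound * (3/2 * norm w2) = 3/2 * (Schottky_bound * norm w2)"
      by simp
    ultimately show ?thesis
      using w(2) norm_ge_zero[of w1] by linarith
  qed
  also have "\<dots> = covering_const * norm w2"
    unfolding covering_const_def by (simp add: algebra_simps)
  finally show False
    using z(2) by simp
qed

section \<open>Growth of the maximum modulus and of its iterates\<close>

lemma holomorphic_funpow:
  assumes "f holomorphic_on (UNIV :: complex set)"
  shows "(f ^^ n) holomorphic_on UNIV"
proof (induction n)
  case 0
  then show ?case by (simp add: id_def)
next
  case (Suc n)
  then show ?case
    using holomorphic_on_compose_gen[OF Suc assms] by (simp add: o_def)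
qed

(* Maximum principle for f(z) / z^k on the annulus 1 <= |z| <= s; the inner circle is irrelevant
   because M(r) / r^k eventually exceeds M(1). *)
lemma max_modulus_power_growth:
  assumes "transcendental_entire f"
  shows "\<exists>R>0. \<forall>r s. R \<le> r \<longrightarrow> r \<le> s \<longrightarrow> max_modulus f r * s ^ k \<le> max_modulus f s * r ^ k"
proof -
  have hol: "f holomorphic_on UNIV"
    using assms by (simp add: transcendental_entire_def)
  \<comment> \<open>The exponent exceeds \<open>k\<close> by one because a spare factor r >= M(1) is
    needed: M(1) r^k <= r^(k+1) < M(r).\<close>
  obtain R0 where R0: "R0 > 0" "\<And>r. r \<ge> R0 \<Longrightarrow> r ^ Suc k < max_modulus f r"
    using max_modulus_superpolynomial[OF assms] by blast
  define R where "R = max (max R0 1) (max_modulus f 1)"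
  have "max_modulus f r * s ^ k \<le> max_modulus f s * r ^ k" if r: "R \<le> r" and s: "r \<le> s" for r s
  proof -
    have r1: "1 \<le> r" "R0 \<le> r" "max_modulus f 1 \<le> r"
      using r by (auto simp: R_def)
    obtain z where z: "norm z = r" "max_modulus f r = norm (f z)"
      using max_modulus_attained[OF entire_cont[OF hol], of r] r1 by auto
    define A where "A = cball 0 s - ball (0::complex) 1"
    define B where "B = max (max_modulus f 1) (max_modulus f s / s ^ k)"
    define h where "h = (\<lambda>z. f z / z ^ k)"
    have A0: "x \<noteq> 0" if "x \<in> A" for x
      using that by (auto simp: A_def)
    have clA: "closed A"
      by (simp add: A_def closed_Diff)
    have holh: "h holomorphic_on A"
      unfolding h_def using A0 by (intro holomorphic_intros holomorphic_on_subset[OF hol]) auto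
    have "norm (h z) \<le> B"
    proof (rule maximum_modulus_frontier[of h A])
      show "h holomorphic_on interior A"
        using holh interior_subset holomorphic_on_subset by blast
      show "continuous_on (closure A) h"
        using holh clA by (simp add: holomorphic_on_imp_continuous_on)
      show "bounded A"
        unfolding A_def by (simp add: bounded_diff)
      show "z \<in> A"
        using z r1 s by (simp add: A_def)
      show "norm (h w) \<le> B" if "w \<in> frontier A" for w
      proof -
        have "ball 0 s - cball (0::complex) 1 \<subseteq> interior A"
          by (rule interior_maximal) (auto simp: A_def)
        moreover have "w \<in> A" "w \<notin> interior A"
          using that clA by (auto simp: frontier_def)
        ultimately have "w \<in> cball 0 s" "w \<notin> ball 0 1" "w \<notin> ball 0 s - cball 0 1"
          by (auto simp: A_def)
        then have "norm w = s \<or> norm w = 1"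
          by auto
        then show ?thesis
        proof
          assume w: "norm w = s"
          have "norm (f w) \<le> max_modulus f s"
            using w r1 s by (intro norm_le_max_modulus[OF hol]) auto
          then have "norm (h w) \<le> max_modulus f s / s ^ k"
            using w r1 s by (simp add: h_def norm_divide norm_power divide_right_mono)
          then show ?thesis by (simp add: B_def)
        next
          assume w: "norm w = 1"
          have "norm (f w) \<le> max_modulus f 1"
            using w by (intro norm_le_max_modulus[OF hol]) auto
          then have "norm (h w) \<le> max_modulus f 1"
            using w by (simp add: h_def norm_divide norm_power)
          then show ?thesis by (simp add: B_def)
        qed
      qed
    qed
    then have le: "max_modulus f r / r ^ k \<le> B"
      using z by (simp add: h_def norm_divide norm_power)
    have "max_modulus f 1 * r ^ k \<le> r * r ^ k"
      using r1 by (intro mult_right_mono) auto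
    also have "\<dots> < max_modulus f r"
      using R0(2)[OF r1(2)] by simp
    finally have "max_modulus f 1 < max_modulus f r / r ^ k"
      using r1 by (simp add: field_simps)
    with le have "max_modulus f r / r ^ k \<le> max_modulus f s / s ^ k"
      by (auto simp: B_def)
    then show ?thesis
      using r1 s by (simp add: field_simps)
  qed
  then show ?thesis
    using R0(1) by (intro exI[of _ R]) (auto simp: R_def)
qed

lemma max_modulus_dominates_linear:
  assumes "transcendental_entire f"
  shows "\<exists>R>0. \<forall>r\<ge>R. C * r \<le> max_modulus f r"
proof -
  obtain R where R: "R > 0" "\<And>r. r \<ge> R \<Longrightarrow> r ^ 2 < max_modulus f r"
    using max_modulus_superpolynomial[OF assms] by blast
  have "C * r \<le> max_modulus f r" if "r \<ge> max R C" for r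
  proof -
    have "C * r \<le> r * r"
      using that R(1) by (intro mult_right_mono) auto
    then show ?thesis
      using R(2)[of r] that by (simp add: power2_eq_square)
  qed
  then show ?thesis
    using R(1) by (intro exI[of _ "max R C"]) auto
qed

text \<open>Otherwise f omits, on the disc, a value on each of the circles of radii \<rho> and
  2\<rho>; after rescaling to the unit disc this contradicts
  \<open>attains_one_of_two_values\<close>, as f is large somewhere on the circle of radius r/2.
  Which circle is covered stays undetermined, hence the existential.\<close>

lemma image_disc_contains_circle:
  assumes hol: "f holomorphic_on UNIV" and "0 < r" "0 < \<rho>" "norm (f 0) \<le> \<rho>"
    and large: "covering_const * (2 * \<rho>) < max_modulus f (r / 2)"
  shows "\<exists>\<rho>'\<ge>\<rho>. sphere 0 \<rho>' \<subseteq> f ` cball 0 r"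
proof (rule ccontr)
  assume neg: "\<not> ?thesis"
  then have "\<not> sphere 0 \<rho> \<subseteq> f ` cball 0 r" "\<not> sphere 0 (2 * \<rho>) \<subseteq> f ` cball 0 r"
    using \<open>0 < \<rho>\<close> by auto
  then obtain w1 w2 where w: "w1 \<in> sphere 0 \<rho>" "w1 \<notin> f ` cball 0 r"
      "w2 \<in> sphere 0 (2 * \<rho>)" "w2 \<notin> f ` cball 0 r"
    by blast
  obtain z where z: "norm z = r / 2" "max_modulus f (r / 2) = norm (f z)"
    using max_modulus_attained[OF entire_cont[OF hol], of "r / 2"] \<open>0 < r\<close> by auto
  define g where "g = (\<lambda>\<zeta>. f (of_real r * \<zeta>))"
  have im: "g ` cball 0 1 \<subseteq> f ` cball 0 r"
    using \<open>0 < r\<close> by (auto simp: g_def norm_mult intro!: imageI mult_left_le)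
  have "g holomorphic_on cball 0 1"
    unfolding g_def
    by (intro holomorphic_on_compose_gen[OF _ hol, unfolded o_def]) (auto intro!: holomorphic_intros)
  moreover have "g (z / of_real r) = f z" "norm (z / of_real r) = 1/2"
    using z \<open>0 < r\<close> by (auto simp: g_def norm_divide)
  moreover have "norm w1 = \<rho>" "norm w2 = 2 * \<rho>"
    using w by auto
  ultimately have "w1 \<in> g ` cball 0 1 \<or> w2 \<in> g ` cball 0 1"
    using z large assms(3,4)
    by (intro attains_one_of_two_values[where z = "z / of_real r"]) (auto simp: g_def)
  then show False
    using im w by blast
qed

(* Induction from the inside: f maps the disc of radius 4r over a circle of radius at least 4 M(r),
   so the induction hypothesis applies with M(r) in place of r. *)
lemma max_modulus_iterate_lower_bound:
  assumes "transcendental_entire f"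
  shows "\<exists>R>0. \<forall>r\<ge>R. \<forall>N. \<exists>z. norm z \<le> 4 * r \<and> (max_modulus f ^^ N) r \<le> norm ((f ^^ N) z)"
proof -
  have hol: "f holomorphic_on UNIV"
    using assms by (simp add: transcendental_entire_def)
  \<comment> \<open>This makes M(2r) >= 2^k M(r) exceed 8 \<open>covering_const\<close> M(r), the
    size that \<open>image_disc_contains_circle\<close> requires for the disc of radius 4r and
    \<rho> = 4 M(r).\<close>
  obtain k where k: "8 * covering_const < 2 ^ k"
    using real_arch_pow[of 2 "8 * covering_const"] by auto
  obtain R1 where R1: "R1 > 0" "\<And>r s. R1 \<le> r \<Longrightarrow> r \<le> s \<Longrightarrow>
      max_modulus f r * s ^ k \<le> max_modulus f s * r ^ k"
    using max_modulus_power_growth[OF assms, of k] by blast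
  obtain R2 where R2: "R2 > 0" "\<And>r. r \<ge> R2 \<Longrightarrow> 1 * r \<le> max_modulus f r"
    using max_modulus_dominates_linear[OF assms, of 1] by blast
  define R where "R = max R1 R2"
  have "\<exists>z. norm z \<le> 4 * r \<and> (max_modulus f ^^ N) r \<le> norm ((f ^^ N) z)" if "r \<ge> R" for r N
    using that
  proof (induction N arbitrary: r)
    case 0
    then show ?case
      using R1(1) by (intro exI[of _ "of_real r"]) (auto simp: R_def)
  next
    case (Suc N)
    define \<rho> where "\<rho> = 4 * max_modulus f r"
    have r: "0 < r" "R1 \<le> r" "R2 \<le> r"
      using Suc.prems R1(1) by (auto simp: R_def)
    have M: "r \<le> max_modulus f r"
      using R2(2)[OF r(3)] by simp
    have "max_modulus f r * (2 ^ k * r ^ k) \<le> max_modulus f (2 * r) * r ^ k"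
      using R1(2)[OF r(2), of "2 * r"] r by (simp add: power_mult_distrib)
    then have "(max_modulus f r * 2 ^ k) * r ^ k \<le> max_modulus f (2 * r) * r ^ k"
      by (simp only: mult.assoc)
    then have "max_modulus f r * 2 ^ k \<le> max_modulus f (2 * r)"
      using r by (meson mult_right_le_imp_le zero_less_power)
    moreover have "max_modulus f r * (8 * covering_const) < max_modulus f r * 2 ^ k"
      using k M r by (intro mult_strict_left_mono) auto
    ultimately have "covering_const * (2 * \<rho>) < max_modulus f (4 * r / 2)"
      by (simp add: \<rho>_def algebra_simps)
    moreover have "norm (f 0) \<le> \<rho>" "0 < \<rho>"
      using norm_le_max_modulus[OF hol, of 0 r] r M by (auto simp: \<rho>_def)
    ultimately obtain \<rho>' where \<rho>': "\<rho> \<le> \<rho>'" "sphere 0 \<rho>' \<subseteq> f ` cball 0 (4 * r)"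
      using image_disc_contains_circle[OF hol, of "4 * r" \<rho>] r by auto
    obtain w where w: "norm w \<le> \<rho>" "(max_modulus f ^^ N) (max_modulus f r) \<le> norm ((f ^^ N) w)"
      using Suc.IH[of "max_modulus f r"] M Suc.prems by (auto simp: \<rho>_def)
    \<comment> \<open>By the maximum principle \<open>w\<close> may be replaced by a point of the
      covered circle, which has a preimage in the disc of radius 4r.\<close>
    obtain w' where w': "norm w' = \<rho>'" "max_modulus (f ^^ N) \<rho>' = norm ((f ^^ N) w')"
      using max_modulus_attained[OF entire_cont[OF holomorphic_funpow[OF hol, of N]], of \<rho>']
        \<rho>'(1) \<open>0 < \<rho>\<close> by auto
    have "norm ((f ^^ N) w) \<le> norm ((f ^^ N) w')"
      using norm_le_max_modulus[OF holomorphic_funpow[OF hol, of N], of w \<rho>'] w w' \<rho>' \<open>0 < \<rho>\<close> by auto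
    moreover obtain z where "norm z \<le> 4 * r" "w' = f z"
      using \<rho>'(2) w'(1) by force
    ultimately show ?case
      using w(2) by (intro exI[of _ z]) (auto simp: funpow_Suc_right simp del: funpow.simps)
  qed
  then show ?thesis
    using R1(1) by (intro exI[of _ R]) (auto simp: R_def)
qed

section \<open>Low points\<close>

definition closed_annulus :: "real \<Rightarrow> real \<Rightarrow> complex set" where
  "closed_annulus C T = {z. T / C \<le> norm z \<and> norm z \<le> C * T}"

lemma compact_closed_annulus: "compact (closed_annulus C T)"
proof -
  have "closed_annulus C T = cball 0 (C * T) - ball 0 (T / C)"
    by (auto simp: closed_annulus_def)
  then show ?thesis
    by (simp add: compact_diff)
qed

text \<open>This logarithmic coordinate around \<open>a\<close> transfers Schottky's theorem from
  the unit disc to an annulus.\<close>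

lemma mult_exp_in_closed_annulus:
  assumes "0 \<le> L" "norm \<zeta> \<le> 1"
  shows "a * exp (of_real L * \<zeta>) \<in> closed_annulus (exp L) (norm a)"
proof -
  have "\<bar>Re \<zeta>\<bar> \<le> 1"
    using assms(2) abs_Re_le_cmod[of \<zeta>] by linarith
  then have "- 1 \<le> Re \<zeta>" "Re \<zeta> \<le> 1"
    by linarith+
  from this[THEN mult_left_mono, OF assms(1)]
  have "exp (- L) \<le> exp (L * Re \<zeta>)" "exp (L * Re \<zeta>) \<le> exp L"
    by auto
  then have "norm a * exp (- L) \<le> norm a * exp (L * Re \<zeta>)"
    "norm a * exp (L * Re \<zeta>) \<le> norm a * exp L"
    by (auto intro!: mult_left_mono)
  then show ?thesis
    by (simp add: closed_annulus_def norm_mult exp_minus divide_inverse mult.commute)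
qed

definition low_points :: "(complex \<Rightarrow> complex) \<Rightarrow> complex set" where
  "low_points f = {u. \<exists>m\<ge>1. norm ((f ^^ m) u) \<le> 1}"

text \<open>If low points were bounded, |f| > 1 would hold near infinity, so 1/f(1/z) would be
  bounded near 0 and extend holomorphically. Then 1/f has a limit at infinity, which forces f to be
  a polynomial.\<close>

lemma low_points_unbounded:
  assumes "transcendental_entire f"
  shows "\<exists>u\<in>low_points f. X \<le> norm u"
proof (rule ccontr)
  assume neg: "\<not> ?thesis"
  have hol: "f holomorphic_on UNIV"
    using assms by (simp add: transcendental_entire_def)
  define r where "r = 1 / max X 1"
  have r: "0 < r"
    by (simp add: r_def)
  have big: "1 < norm (f (inverse z))" if z: "z \<in> ball 0 r - {0}" for z
  proof -
    have "max X 1 * norm z < 1"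
      using z by (simp add: r_def field_simps)
    then have "max X 1 < 1 / norm z"
      using z by (subst pos_less_divide_eq) auto
    then have "max X 1 < norm (inverse z)"
      unfolding norm_inverse by (simp only: inverse_eq_divide)
    then have "inverse z \<notin> low_points f"
      using neg by force
    then have "\<not> norm ((f ^^ 1) (inverse z)) \<le> 1"
      unfolding low_points_def by blast
    then show ?thesis
      by simp
  qed
  have "inverse \<circ> f \<circ> inverse holomorphic_on ball 0 r - {0}"
    using big
    by (intro holomorphic_on_compose holomorphic_intros holomorphic_on_subset[OF hol]) force+
  moreover have "\<exists>B. \<forall>\<^sub>F z in at 0. norm ((inverse \<circ> f \<circ> inverse) z) \<le> B"
  proof
    have "\<forall>\<^sub>F z in at 0. z \<in> ball 0 r - {0}"
      using r by (auto simp: eventually_at dist_commute intro!: exI[of _ r])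
    then show "\<forall>\<^sub>F z in at 0. norm ((inverse \<circ> f \<circ> inverse) z) \<le> 1"
    proof eventually_elim
      case (elim z)
      then show ?case
        using big[of z] by (simp add: norm_inverse inverse_le_1_iff)
    qed
  qed
  ultimately obtain g where g: "g holomorphic_on ball 0 r"
      "\<And>z. z \<in> ball 0 r - {0} \<Longrightarrow> g z = (inverse \<circ> f \<circ> inverse) z"
    using holomorphic_on_extend_bounded[of "inverse \<circ> f \<circ> inverse" "ball 0 r" 0] r by auto
  have "g \<midarrow>0\<rightarrow> g 0"
    using g(1) r by (metis centre_in_ball continuous_at continuous_on_eq_continuous_at
        holomorphic_on_imp_continuous_on open_ball)
  then have "(inverse \<circ> f \<circ> inverse) \<midarrow>0\<rightarrow> g 0"
    by (rule Lim_transform_within_open[OF _ open_ball[of 0 r]]) (use g(2) r in auto)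
  then have "((inverse \<circ> f) \<longlongrightarrow> g 0) at_infinity"
    by (simp add: lim_at_infinity_0)
  then obtain a n where "\<And>z. f z = (\<Sum>i\<le>n. a i * z ^ i)"
    using pole_at_infinity[OF hol] by metis
  then have "f = poly (\<Sum>i\<le>n. monom (a i) i)"
    by (auto simp: poly_sum poly_monom)
  then show False
    using assms unfolding transcendental_entire_def by blast
qed

(* If f omits both 0 and v near a circle of radius \<rho> with M(\<rho>) <= |v| < M(2\<rho>), then Schottky's
   theorem in the logarithmic coordinate bounds M(b\<rho>) by a multiple of |v|, too small for large b. *)
lemma low_points_successor:
  assumes "transcendental_entire f" "1 \<le> C"
  shows "\<exists>R>0. \<forall>v\<in>low_points f. R \<le> norm v \<longrightarrow> (\<exists>u\<in>low_points f.
    0 < norm u \<and> C * norm u \<le> norm v \<and> norm v \<le> max_modulus f (max_modulus f (norm u)) \<and>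
    norm u \<le> max_modulus f (norm u))"
proof -
  have hol: "f holomorphic_on UNIV"
    using assms by (simp add: transcendental_entire_def)
  \<comment> \<open>With this value the linear growth estimate gives M(b\<rho>) >= (b/2) M(2\<rho>)
    = \<open>Schottky_bound\<close> M(2\<rho>), which is more than Schottky's bound in terms of |v|
    < M(2\<rho>) allows.\<close>
  define b where "b = 2 * Schottky_bound"
  have b: "2 \<le> b"
    using Schottky_bound_ge_1 by (simp add: b_def)
  obtain R1 where R1: "R1 > 0" "\<And>r s. R1 \<le> r \<Longrightarrow> r \<le> s \<Longrightarrow>
      max_modulus f r * s ^ 1 \<le> max_modulus f s * r ^ 1"
    using max_modulus_power_growth[OF assms(1), of 1] by blast
  \<comment> \<open>The point u will satisfy \<rho>/b^2 <= |u| <= b^2 \<rho>. The factor 2 b^2 then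
    yields 2\<rho> <= M(|u|), and C b^2 yields C |u| <= M(\<rho>) <= |v|.\<close>
  define K where "K = 2 * C * b ^ 2"
  have K: "2 * b ^ 2 \<le> K" "C * b ^ 2 \<le> K" "1 \<le> K"
  proof -
    have "1 * b ^ 2 \<le> C * b ^ 2" "1 \<le> b ^ 2"
      using assms(2) b by (auto intro!: mult_right_mono one_le_power)
    then show "2 * b ^ 2 \<le> K" "C * b ^ 2 \<le> K" "1 \<le> K"
      by (auto simp: K_def)
  qed
  obtain R2 where R2: "R2 > 0" "\<And>r. r \<ge> R2 \<Longrightarrow> K * r \<le> max_modulus f r"
    using max_modulus_dominates_linear[OF assms(1), of K] by blast
  define R0 where "R0 = b ^ 2 * max R1 R2"
  have b2: "1 \<le> b ^ 2"
    using b by (simp add: one_le_power)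
  have R0: "R0 > 0" "R0 / b ^ 2 \<ge> R2" "R0 \<ge> R1" "R0 \<ge> R2"
  proof -
    show "R0 > 0" "R0 / b ^ 2 \<ge> R2"
      using b R1(1) by (auto simp: R0_def)
    have "1 * max R1 R2 \<le> R0"
      unfolding R0_def using b2 R1(1) by (intro mult_right_mono) auto
    then show "R0 \<ge> R1" "R0 \<ge> R2"
      by auto
  qed
  have "\<exists>u\<in>low_points f. 0 < norm u \<and> C * norm u \<le> norm v \<and>
      norm v \<le> max_modulus f (max_modulus f (norm u)) \<and> norm u \<le> max_modulus f (norm u)"
    if v: "v \<in> low_points f" and vR: "max_modulus f R0 \<le> norm v" for v
  proof -
    \<comment> \<open>\<rho> is \<open>2 ^ j * R0\<close>, where \<open>Suc j\<close> is the first
      number of doublings that brings the maximum modulus above |v|.\<close>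
    obtain \<rho> where \<rho>: "R0 \<le> \<rho>" "max_modulus f \<rho> \<le> norm v" "norm v < max_modulus f (2 * \<rho>)"
    proof -
      obtain n where n: "norm v / R0 < 2 ^ n"
        using real_arch_pow[of 2 "norm v / R0"] by auto
      define P where "P = (\<lambda>j. norm v < max_modulus f (2 ^ j * R0))"
      have "1 * R0 \<le> 2 ^ n * R0"
        using R0(1) by (intro mult_right_mono one_le_power) auto
      then have "R2 \<le> 2 ^ n * R0"
        using R0(4) by linarith
      then have "1 * (2 ^ n * R0) \<le> K * (2 ^ n * R0)" "K * (2 ^ n * R0) \<le> max_modulus f (2 ^ n * R0)"
        using R2(2)[of "2 ^ n * R0"] R0 K(3) by (auto intro!: mult_right_mono)
      moreover have "norm v < 2 ^ n * R0"
        using n R0(1) by (simp add: field_simps)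
      ultimately have "P n"
        unfolding P_def by linarith
      then have "P (LEAST j. P j)"
        by (rule LeastI)
      moreover have "\<not> P 0"
        using vR by (simp add: P_def)
      ultimately obtain j where j: "(LEAST j. P j) = Suc j" "P (Suc j)"
        by (metis not0_implies_Suc)
      then have "\<not> P j"
        by (metis lessI not_less_Least)
      moreover have "1 * R0 \<le> 2 ^ j * R0"
        using R0(1) by (intro mult_right_mono one_le_power) auto
      ultimately show thesis
        using j(2) by (intro that[of "2 ^ j * R0"]) (auto simp: P_def mult.assoc)
    qed
    have \<rho>0: "0 < \<rho>"
      using \<rho>(1) R0(1) by linarith
    have v0: "v \<noteq> 0"
      using \<rho>(2) R2(2)[of \<rho>] \<rho>(1) R0 K(3) \<rho>0
      by (metis mult_pos_pos norm_zero not_le order_trans zero_less_one less_le_trans)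
    obtain u where u: "u \<in> closed_annulus (b ^ 2) \<rho>" "f u = 0 \<or> f u = v"
    proof (rule ccontr)
      assume "\<not> thesis"
      with that have omit: "f u \<noteq> 0" "f u \<noteq> v" if "u \<in> closed_annulus (b ^ 2) \<rho>" for u
        using that by blast+
      obtain z where z: "norm z = b * \<rho>" "max_modulus f (b * \<rho>) = norm (f z)"
        using max_modulus_attained[OF entire_cont[OF hol], of "b * \<rho>"] b \<rho>0 by auto
      \<comment> \<open>The logarithmic disc is centred at z/b, of modulus \<rho>; since exp(L/2) =
        b, the point 1/2 is sent to z, where |f| equals M(b\<rho>).\<close>
      define L where "L = ln (b ^ 2)"
      define h where "h = (\<lambda>\<zeta>. z / of_real b * exp (of_real L * \<zeta>))"
      have L: "0 \<le> L" "exp L = b ^ 2"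
        using b b2 by (auto simp: L_def)
      have nz: "norm (z / of_real b) = \<rho>"
        using z(1) b by (simp add: norm_divide)
      have h: "h \<zeta> \<in> closed_annulus (b ^ 2) \<rho>" if "\<zeta> \<in> cball 0 1" for \<zeta>
        using mult_exp_in_closed_annulus[OF L(1), of \<zeta> "z / of_real b"] that
        unfolding nz L(2) h_def by simp
      have "L / 2 = ln b"
        using b by (simp add: L_def ln_realpow)
      then have "exp (of_real L * (1/2 :: complex)) = of_real b"
        using b by (metis exp_ln exp_of_real mult.right_neutral of_real_divide of_real_numeral
            times_divide_eq_right zero_less_numeral less_le_trans)
      then have hhalf: "h (1/2) = z"
        using b by (simp add: h_def)
      have "norm ((f \<circ> h) (1/2) - 0) \<le> Schottky_bound * norm (v - 0)"
      proof (rule Schottky_two_values[of "f \<circ> h" 0 v "1/2"])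
        show "f \<circ> h holomorphic_on cball 0 1"
          by (intro holomorphic_on_compose_gen[OF _ hol]) (auto simp: h_def intro!: holomorphic_intros)
        show "0 \<notin> (f \<circ> h) ` cball 0 1" "v \<notin> (f \<circ> h) ` cball 0 1"
          using omit h by fastforce+
        have "norm (f (h 0)) \<le> max_modulus f \<rho>"
          using nz \<rho>0 by (intro norm_le_max_modulus[OF hol]) (auto simp: h_def)
        then have "norm (f (h 0)) \<le> 2 * norm v"
          using \<rho>(2) norm_ge_zero[of v] by linarith
        then show "norm ((f \<circ> h) 0 - 0) \<le> 2 * norm (v - 0)"
          by simp
      qed (use v0 in auto)
      then have "max_modulus f (b * \<rho>) \<le> Schottky_bound * norm v"
        using hhalf z(2) by simp
      also have "\<dots> < Schottky_bound * max_modulus f (2 * \<rho>)"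
        using \<rho>(3) Schottky_bound_ge_1 by (intro mult_strict_left_mono) auto
      finally have "2 * max_modulus f (b * \<rho>) < b * max_modulus f (2 * \<rho>)"
        by (simp add: b_def)
      moreover have "max_modulus f (2 * \<rho>) * (b * \<rho>) \<le> max_modulus f (b * \<rho>) * (2 * \<rho>)"
        using R1(2)[of "2 * \<rho>" "b * \<rho>"] \<rho>(1) R0 \<rho>0 b by simp
      then have "(b * max_modulus f (2 * \<rho>)) * \<rho> \<le> (2 * max_modulus f (b * \<rho>)) * \<rho>"
        by (simp add: mult_ac)
      then have "b * max_modulus f (2 * \<rho>) \<le> 2 * max_modulus f (b * \<rho>)"
        using \<rho>0 by simp
      ultimately show False
        by linarith
    qed
    have low: "u \<in> low_points f"
      using u(2)
    proof
      assume "f u = 0"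
      then show ?thesis
        unfolding low_points_def by (auto intro!: exI[of _ 1])
    next
      assume fu: "f u = v"
      obtain m where "m \<ge> 1" "norm ((f ^^ m) v) \<le> 1"
        using v by (auto simp: low_points_def)
      then have "norm ((f ^^ Suc m) u) \<le> 1"
        using fu by (simp add: funpow_swap1)
      then show ?thesis
        unfolding low_points_def by (auto intro!: exI[of _ "Suc m"])
    qed
    have nu: "\<rho> / b ^ 2 \<le> norm u" "norm u \<le> b ^ 2 * \<rho>"
      using u(1) by (auto simp: closed_annulus_def)
    have u0: "R2 \<le> norm u"
      using nu(1) R0(2) divide_right_mono[OF \<rho>(1), of "b ^ 2"] b2 by linarith
    have "C * norm u \<le> C * (b ^ 2 * \<rho>)"
      using nu(2) assms(2) by (intro mult_left_mono) auto
    also have "\<dots> \<le> K * \<rho>"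
      using K(2) \<rho>0 by (simp add: mult.assoc[symmetric] mult_right_mono)
    also have "\<dots> \<le> norm v"
      using R2(2)[of \<rho>] \<rho> R0 by linarith
    finally have 1: "C * norm u \<le> norm v" .
    have "\<rho> \<le> norm u * b ^ 2"
      using nu(1) b2 by (subst (asm) pos_divide_le_eq) auto
    then have "2 * \<rho> \<le> 2 * (b ^ 2 * norm u)"
      by (simp add: mult.commute)
    also have "\<dots> \<le> K * norm u"
      using K(1) by (simp add: mult.assoc[symmetric] mult_right_mono)
    also have "\<dots> \<le> max_modulus f (norm u)"
      using R2(2)[OF u0] .
    finally have "max_modulus f (2 * \<rho>) \<le> max_modulus f (max_modulus f (norm u))"
      using \<rho>0 by (intro max_modulus_mono[OF hol]) auto
    moreover have "1 * norm u \<le> K * norm u"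
      using K(3) by (intro mult_right_mono) auto
    then have "norm u \<le> max_modulus f (norm u)"
      using R2(2)[OF u0] by linarith
    ultimately show ?thesis
      using low 1 u0 R2(1) \<rho>(3) by (intro bexI[of _ u]) auto
  qed
  moreover have "0 < max_modulus f R0"
    using R2(2)[OF R0(4)] R0(1) K(3) by (metis mult_pos_pos less_le_trans zero_less_one)
  ultimately show ?thesis
    by (intro exI[of _ "max_modulus f R0"]) auto
qed

section \<open>Covering of annuli\<close>

abbreviation annulus :: "real \<Rightarrow> complex set" where
  "annulus \<equiv> closed_annulus (exp (2 * pi))"

text \<open>Were a point missed in each annulus, F in the logarithmic coordinate around u would omit
  both. Their moduli are known only up to the factor exp(2 pi); this accounts for its square in
  \<open>sep\<close> and for the factors in \<open>low\<close> and \<open>high\<close>.\<close>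

lemma annulus_covers_one_of_two:
  assumes hol: "F holomorphic_on UNIV" and "u \<noteq> 0" "0 < S1"
    and sep: "2 * exp (2 * pi) ^ 2 * S1 \<le> S2"
    and low: "exp (2 * pi) * norm (F u) \<le> S1"
    and high: "norm z \<le> norm u" "covering_const * (exp (2 * pi) * S2) < norm (F z)"
  shows "annulus S1 \<subseteq> F ` annulus (norm u) \<or> annulus S2 \<subseteq> F ` annulus (norm u)"
proof (rule ccontr)
  assume neg: "\<not> ?thesis"
  define C where "C = exp (2 * pi)"
  have C: "C > 0"
    by (simp add: C_def)
  obtain w1 w2 where w: "w1 \<in> annulus S1" "w1 \<notin> F ` annulus (norm u)"
      "w2 \<in> annulus S2" "w2 \<notin> F ` annulus (norm u)"
    using neg by blast
  have w1: "S1 \<le> C * norm w1" "norm w1 \<le> C * S1" and w2: "S2 \<le> C * norm w2" "norm w2 \<le> C * S2"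
    using w(1,3) C by (auto simp: closed_annulus_def C_def field_simps)
  \<comment> \<open>The large value is moved to the circle through u by the maximum
    principle.\<close>
  obtain z' where z': "norm z' = norm u" "max_modulus F (norm u) = norm (F z')"
    using max_modulus_attained[OF entire_cont[OF hol], of "norm u"] \<open>u \<noteq> 0\<close> by auto
  have high': "covering_const * (C * S2) < norm (F z')"
    using norm_le_max_modulus[OF hol high(1)] \<open>u \<noteq> 0\<close> high(2) z' by (simp add: C_def)
  define h where "h = (\<lambda>\<zeta>. u * exp (of_real (2 * pi) * \<zeta>))"
  \<comment> \<open>A rotation by at most pi takes u to z', so the logarithmic radius 2 pi leaves
    |\<zeta>| <= 1/2; this is the reason for the constant in \<open>annulus\<close>.\<close>
  define \<zeta> where "\<zeta> = \<i> * of_real (Arg (z' / u) / (2 * pi))"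
  have h: "h \<zeta> \<in> annulus (norm u)" if "\<zeta> \<in> cball 0 1" for \<zeta>
    using mult_exp_in_closed_annulus[of "2 * pi" \<zeta> u] that by (simp add: h_def)
  have "h \<zeta> = u * exp (\<i> * of_real (Arg (z' / u)))"
    by (simp add: h_def \<zeta>_def)
  also have "exp (\<i> * of_real (Arg (z' / u))) = z' / u"
    using Arg_eq[of "z' / u"] z'(1) \<open>u \<noteq> 0\<close> by (cases "z' = 0") (auto simp: norm_divide)
  finally have "h \<zeta> = z'"
    using \<open>u \<noteq> 0\<close> by simp
  have "w1 \<in> (F \<circ> h) ` cball 0 1 \<or> w2 \<in> (F \<circ> h) ` cball 0 1"
  proof (rule attains_one_of_two_values)
    show "F \<circ> h holomorphic_on cball 0 1"
      by (intro holomorphic_on_compose_gen[OF _ hol]) (auto simp: h_def intro!: holomorphic_intros)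
    show "w1 \<noteq> 0"
      using w1 \<open>0 < S1\<close> by auto
    have "C * (2 * norm w1) \<le> C * (2 * (C * S1))"
      using w1(2) C by simp
    also have "\<dots> \<le> C * norm w2"
      using order_trans[OF sep w2(1)[unfolded C_def]] by (simp only: C_def power2_eq_square mult_ac)
    finally show "2 * norm w1 \<le> norm w2"
      using C by simp
    have "C * norm (F u) \<le> C * norm w1"
      using order_trans[OF low w1(1)] by (simp add: C_def)
    then show "norm ((F \<circ> h) 0) \<le> norm w1"
      using mult_le_cancel_left_pos[OF C] by (simp add: h_def)
    have "\<bar>Arg (z' / u)\<bar> \<le> pi"
      using Arg_bounded[of "z' / u"] by auto
    then show "norm \<zeta> \<le> 1/2"
      by (simp add: \<zeta>_def norm_mult norm_divide)
    have "covering_const * norm w2 \<le> covering_const * (C * S2)"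
      using w2(2) covering_const_ge_3 by (intro mult_left_mono) auto
    then show "covering_const * norm w2 < norm ((F \<circ> h) \<zeta>)"
      using high' \<open>h \<zeta> = z'\<close> by simp
  qed
  then show False
    using w h by auto
qed

section \<open>Slowly growing orbits\<close>

lemma funpow_funpow: "(g ^^ m) ((g ^^ n) x) = (g ^^ (m + n)) x"
  by (simp add: funpow_add)

lemma admissible_mono: "admissible g R \<Longrightarrow> R \<le> R' \<Longrightarrow> admissible g R'"
  unfolding admissible_def by auto

lemma iter_less_Suc:
  assumes "admissible g R"
  shows "(g ^^ n) R < (g ^^ Suc n) R"
  using admissible_iter[OF assms, of n] assms by (simp add: admissible_def)

lemma iter_le_iter:
  assumes "admissible g R" "m \<le> n"
  shows "(g ^^ m) R \<le> (g ^^ n) R"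
  using lift_Suc_mono_le[of "\<lambda>n. (g ^^ n) R"] iter_less_Suc[OF assms(1)] assms(2)
  by (meson less_imp_le)

lemma norm_funpow_le:
  assumes hol: "f holomorphic_on UNIV" and adm: "admissible (max_modulus f) R"
    and "norm z \<le> R"
  shows "norm ((f ^^ n) z) \<le> (max_modulus f ^^ n) R"
proof (induction n)
  case (Suc n)
  have "0 < (max_modulus f ^^ n) R"
    using admissible_iter[OF adm, of n] adm by (auto simp: admissible_def)
  then show ?case
    using norm_le_max_modulus[OF hol Suc] by simp
qed (use assms in simp)

text \<open>One leg of the itinerary, of arbitrarily large length N. The upper bound on |u'| loses
  one iterate; the lower bound, M^(N+2)(a) against a start at M^9(a), loses at most seven. The
  target is a distant low point v2 or its predecessor v1.\<close>

lemma transit_between_low_points: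
  fixes f :: "complex \<Rightarrow> complex"
  defines "M \<equiv> max_modulus f"
  assumes te: "transcendental_entire f"
  shows "\<exists>D\<ge>1. admissible M D \<and> (\<forall>r\<ge>D. exp (2 * pi) * r \<le> M r) \<and>
    (\<forall>a\<ge>D. \<forall>u\<in>low_points f. (M ^^ 9) a \<le> norm u \<longrightarrow> (\<forall>N0. \<exists>N\<ge>N0. \<exists>u'\<in>low_points f.
      annulus (norm u') \<subseteq> (f ^^ N) ` annulus (norm u) \<and>
      norm u' \<le> (M ^^ (N - 1)) (norm u) \<and> (M ^^ (N + 2)) a \<le> norm u'))"
proof -
  have hol: "f holomorphic_on UNIV"
    using te by (simp add: transcendental_entire_def)
  define C where "C = exp (2 * pi)"
  have C: "1 \<le> C"
    by (simp add: C_def)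
  \<comment> \<open>One linear factor serves three purposes: passing from |u| to |u|/4, absorbing
    the width C of an annulus, and absorbing the covering constant times C.\<close>
  define \<kappa> where "\<kappa> = 4 * (covering_const * C)"
  have \<kappa>: "4 \<le> \<kappa>" "C \<le> \<kappa>" "covering_const * C \<le> \<kappa>" "1 \<le> covering_const * C"
  proof -
    have "1 * C \<le> covering_const * C"
      using covering_const_ge_3 C by (intro mult_right_mono) auto
    then have "1 \<le> covering_const * C" "C \<le> covering_const * C"
      using C by linarith+
    then show "4 \<le> \<kappa>" "C \<le> \<kappa>" "covering_const * C \<le> \<kappa>" "1 \<le> covering_const * C"
      unfolding \<kappa>_def using C by linarith+
  qed
  obtain D1 where D1: "\<And>r. r \<ge> D1 \<Longrightarrow> \<kappa> * r \<le> M r"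
    using max_modulus_dominates_linear[OF te, of \<kappa>] unfolding M_def by blast
  obtain D2 where D2: "\<And>r N. r \<ge> D2 \<Longrightarrow> \<exists>z. norm z \<le> 4 * r \<and> (M ^^ N) r \<le> norm ((f ^^ N) z)"
    using max_modulus_iterate_lower_bound[OF te] unfolding M_def by blast
  have C2: "1 \<le> 2 * C ^ 2"
    using one_le_power[OF C, of 2] by linarith
  obtain D3 where D3: "\<And>v. v \<in> low_points f \<Longrightarrow> D3 \<le> norm v \<Longrightarrow> \<exists>u\<in>low_points f.
      0 < norm u \<and> 2 * C ^ 2 * norm u \<le> norm v \<and> norm v \<le> M (M (norm u)) \<and> norm u \<le> M (norm u)"
    using low_points_successor[OF te C2] unfolding M_def by blast
  define D where "D = max 1 (max D1 D2)"
  have D: "1 \<le> D" "D1 \<le> D" "D2 \<le> D"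
    by (auto simp: D_def)
  have mono: "\<And>r s. 0 < r \<Longrightarrow> r \<le> s \<Longrightarrow> M r \<le> M s"
    unfolding M_def by (rule max_modulus_mono[OF hol])
  have lsc: "\<And>L. 0 < L \<Longrightarrow> L < M L \<Longrightarrow> \<exists>s. 0 < s \<and> s < L \<and> L < M s"
    unfolding M_def by (rule max_modulus_lsc[OF hol])
  have grow: "\<kappa> * r \<le> M r" if "D \<le> r" for r
    using D1 D(2) that by simp
  have adm: "admissible M r" if "D \<le> r" for r
    unfolding admissible_def
  proof (intro conjI allI impI)
    fix s assume "r \<le> s"
    then have s: "D \<le> s" "0 < s"
      using that D(1) by auto
    have "1 * s < \<kappa> * s"
      using s(2) \<kappa>(1) by (intro mult_strict_right_mono) auto
    then show "s < M s"
      using grow[OF s(1)] by linarith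
  qed (use that D(1) in linarith)
  have "\<exists>N\<ge>N0. \<exists>u'\<in>low_points f. annulus (norm u') \<subseteq> (f ^^ N) ` annulus (norm u) \<and>
      norm u' \<le> (M ^^ (N - 1)) (norm u) \<and> (M ^^ (N + 2)) a \<le> norm u'"
    if a: "D \<le> a" and u: "u \<in> low_points f" "(M ^^ 9) a \<le> norm u" for a u N0
  proof -
    obtain m0 where m0: "norm ((f ^^ m0) u) \<le> 1"
      using u(1) by (auto simp: low_points_def)
    \<comment> \<open>Dividing |u| by 4, as the lower bound for f^N demands, costs one of the nine
      iterates.\<close>
    define Y where "Y = (M ^^ 8) a"
    have Y: "D \<le> Y"
      using admissible_iter[OF adm[OF a], of 8] a by (simp add: Y_def)
    have "M Y \<le> norm u"
      using u(2) by (simp add: Y_def eval_nat_numeral)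
    moreover have "4 * Y \<le> \<kappa> * Y"
      using \<kappa>(1) Y D(1) by (intro mult_right_mono) auto
    ultimately have Yu: "Y \<le> norm u / 4"
      using grow[OF Y] by linarith
    then have uD: "D \<le> norm u / 4"
      using Y by linarith
    then have u4: "norm u / 4 \<le> norm u" "0 < norm u"
      using D(1) by auto
    \<comment> \<open>Taking |v2| >= M^J(|u|/4) forces Ns > J, so the leg has at least N0 steps and
      outlasts the m0 steps after which u reaches the unit disc.\<close>
    define J where "J = max N0 m0 + 2"
    obtain v2 where v2: "v2 \<in> low_points f" "max D3 ((M ^^ J) (norm u / 4)) \<le> norm v2"
      using low_points_unbounded[OF te] by blast
    obtain v1 where v1: "v1 \<in> low_points f" "0 < norm v1" "2 * C ^ 2 * norm v1 \<le> norm v2"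
        "norm v2 \<le> M (M (norm v1))" "norm v1 \<le> M (norm v1)"
      using D3[of v2] v2 by auto
    define X where "X = covering_const * (C * norm v2)"
    have v2X: "norm v2 \<le> X"
      using \<kappa>(4) mult_right_mono[of 1 "covering_const * C" "norm v2"] by (simp add: X_def mult.assoc)
    obtain m where "X + 1 \<le> (M ^^ m) (norm u / 4)"
      using iter_reaches[OF adm[OF uD] mono lsc] by blast
    then have ex: "X < (M ^^ m) (norm u / 4)"
      by simp
    (* N is one more than the least number of steps needed to cover both annuli: this guarantees
       the loss of one iterate in the upper bound on norm u'. *)
    define Ns where "Ns = (LEAST N. X < (M ^^ N) (norm u / 4))"
    have Ns: "X < (M ^^ Ns) (norm u / 4)"
      unfolding Ns_def using ex by (rule LeastI)
    have "J < Ns"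
    proof (rule ccontr)
      assume "\<not> J < Ns"
      then have "(M ^^ Ns) (norm u / 4) \<le> (M ^^ J) (norm u / 4)"
        by (intro iter_le_iter[OF adm[OF uD]]) auto
      then show False
        using Ns v2(2) v2X by simp
    qed
    define n where "n = Ns - 2"
    have n: "Ns = Suc (Suc n)" "N0 \<le> n" "m0 \<le> n"
      using \<open>J < Ns\<close> by (auto simp: n_def J_def)
    define N where "N = Suc Ns"
    \<comment> \<open>Minimality of \<open>Ns\<close> bounds M^(n+1)(|u|/4) by a constant multiple
      of |v2|; giving up one more iterate removes the constant.\<close>
    have "\<not> X < (M ^^ Suc n) (norm u / 4)"
      using n(1) not_less_Least[of "Suc n" "\<lambda>N. X < (M ^^ N) (norm u / 4)"] by (simp add: Ns_def)
    then have "M ((M ^^ n) (norm u / 4)) \<le> covering_const * C * norm v2"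
      by (simp add: X_def mult.assoc)
    moreover have nu: "D \<le> (M ^^ n) (norm u / 4)"
      using admissible_iter[OF adm[OF uD], of n] uD by linarith
    then have "covering_const * C * (M ^^ n) (norm u / 4) \<le> \<kappa> * (M ^^ n) (norm u / 4)"
      using \<kappa>(3) D(1) by (intro mult_right_mono) auto
    ultimately have "covering_const * C * (M ^^ n) (norm u / 4) \<le> covering_const * C * norm v2"
      using grow[OF nu] by linarith
    then have "(M ^^ n) (norm u / 4) \<le> norm v2"
      using \<kappa>(4) mult_le_cancel_left_pos[of "covering_const * C"] by force
    moreover have "(M ^^ (n + 8)) a \<le> (M ^^ n) (norm u / 4)"
      unfolding funpow_add o_def Y_def[symmetric] by (rule iter_mono[OF adm[OF Y] Yu mono])
    ultimately have v2low: "(M ^^ (n + 8)) a \<le> norm v2"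
      by linarith
    \<comment> \<open>Here N = n + 3, so N + 2 = n + 5: passing from v2 to v1 gives up two iterates
      for |v2| <= M(M(|v1|)) and one for strictness.\<close>
    have v1low: "(M ^^ (N + 2)) a \<le> norm v1"
    proof (rule ccontr)
      assume "\<not> ?thesis"
      then have lt: "norm v1 \<le> (M ^^ (n + 5)) a"
        by (simp add: N_def n(1) eval_nat_numeral)
      have "M (M (norm v1)) \<le> M (M ((M ^^ (n + 5)) a))"
        using v1(2,5) lt by (intro mono) linarith+
      also have "\<dots> = (M ^^ (n + 7)) a"
        by (simp add: eval_nat_numeral)
      also have "\<dots> < (M ^^ (n + 8)) a"
        using iter_less_Suc[OF adm[OF a], of "n + 7"] by (simp add: eval_nat_numeral)
      finally show False
        using v2low v1(4) by simp
    qed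
    have aN: "(M ^^ (N + 1)) a \<le> (M ^^ (N + 2)) a"
      by (rule iter_le_iter[OF adm[OF a]]) simp
    have "(f ^^ N) u = (f ^^ (N - m0)) ((f ^^ m0) u)"
    proof -
      have "N - m0 + m0 = N"
        using n by (simp add: N_def)
      then show ?thesis
        by (simp only: funpow_funpow)
    qed
    also have "norm \<dots> \<le> (M ^^ (N - m0)) a"
      unfolding M_def
      by (rule norm_funpow_le[OF hol adm[OF a, unfolded M_def]]) (use m0 a D(1) in linarith)
    also have "\<dots> \<le> (M ^^ N) a"
      by (intro iter_le_iter[OF adm[OF a]]) simp
    finally have "C * norm ((f ^^ N) u) \<le> C * (M ^^ N) a"
      using C by (intro mult_left_mono) auto
    also have "\<dots> \<le> \<kappa> * (M ^^ N) a"
      using \<kappa>(2) admissible_iter[OF adm[OF a], of N] a D(1) by (intro mult_right_mono) auto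
    also have "\<dots> \<le> (M ^^ (N + 1)) a"
      using grow[of "(M ^^ N) a"] admissible_iter[OF adm[OF a], of N] a by simp
    finally have low: "C * norm ((f ^^ N) u) \<le> norm v1"
      using aN v1low by linarith
    obtain z where z: "norm z \<le> 4 * (norm u / 4)" "(M ^^ N) (norm u / 4) \<le> norm ((f ^^ N) z)"
      using D2[of "norm u / 4" N] uD D(3) by auto
    have "(M ^^ Ns) (norm u / 4) \<le> (M ^^ N) (norm u / 4)"
      by (intro iter_le_iter[OF adm[OF uD]]) (simp add: N_def)
    then have "covering_const * (C * norm v2) < norm ((f ^^ N) z)"
      using z(2) Ns by (simp add: X_def)
    then have cover: "annulus (norm v1) \<subseteq> (f ^^ N) ` annulus (norm u) \<or>
        annulus (norm v2) \<subseteq> (f ^^ N) ` annulus (norm u)"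
      using annulus_covers_one_of_two[OF holomorphic_funpow[OF hol, of N], of u "norm v1" "norm v2" z]
        low v1 z(1) u4 by (simp add: C_def)
    have "1 * norm v1 \<le> 2 * C ^ 2 * norm v1"
      using C2 by (intro mult_right_mono) auto
    then have v12: "norm v1 \<le> norm v2"
      using v1(3) by linarith
    have "(M ^^ Ns) (norm u / 4) \<le> (M ^^ Ns) (norm u)"
      by (rule iter_mono[OF adm[OF uD] u4(1) mono])
    then have up: "norm v2 \<le> (M ^^ (N - 1)) (norm u)"
      using Ns v2X by (simp add: N_def)
    have "N0 \<le> N"
      using n by (simp add: N_def)
    then show ?thesis
      using cover v12 up v1low v1(1) v2(1) by (meson order_trans)
  qed
  moreover have "C * r \<le> M r" if "D \<le> r" for r
  proof -
    have "C * r \<le> \<kappa> * r"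
      using \<kappa>(2) that D(1) by (intro mult_right_mono) auto
    then show ?thesis
      using grow[OF that] by linarith
  qed
  ultimately show ?thesis
    using D(1) adm[of D] unfolding C_def by (intro exI[of _ D]) auto
qed

section \<open>Construction of a slow orbit\<close>

lemma mu_le_max_modulus:
  assumes "1 \<le> max_modulus f r" "\<epsilon> < 1"
  shows "mu \<epsilon> f r \<le> max_modulus f r"
  unfolding mu_def using powr_mono[of \<epsilon> 1 "max_modulus f r"] assms by simp

lemma slow_point_of_not_eps_regular:
  assumes te: "transcendental_entire f" and \<epsilon>: "0 < \<epsilon>" "\<epsilon> < 1" and irreg: "\<not> eps_regular \<epsilon> f"
  shows "\<exists>\<zeta>. \<zeta> \<in> quite_fast_escaping_eps \<epsilon> f \<and> \<zeta> \<notin> fast_escaping f"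
proof -
  have hol: "f holomorphic_on UNIV"
    using te by (simp add: transcendental_entire_def)
  define C where "C = exp (2 * pi)"
  define M where "M = max_modulus f"
  have C: "1 \<le> C"
    by (simp add: C_def)
  have mono: "\<And>r s. 0 < r \<Longrightarrow> r \<le> s \<Longrightarrow> M r \<le> M s"
    unfolding M_def by (rule max_modulus_mono[OF hol])
  have lsc: "\<And>L. 0 < L \<Longrightarrow> L < M L \<Longrightarrow> \<exists>s. 0 < s \<and> s < L \<and> L < M s"
    unfolding M_def by (rule max_modulus_lsc[OF hol])
  obtain D where D: "1 \<le> D" "admissible M D" "\<And>r. D \<le> r \<Longrightarrow> C * r \<le> M r"
    and transit: "\<And>a u N0. D \<le> a \<Longrightarrow> u \<in> low_points f \<Longrightarrow> (M ^^ 9) a \<le> norm u \<Longrightarrow>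
      \<exists>N\<ge>N0. \<exists>u'\<in>low_points f. annulus (norm u') \<subseteq> (f ^^ N) ` annulus (norm u) \<and>
        norm u' \<le> (M ^^ (N - 1)) (norm u) \<and> (M ^^ (N + 2)) a \<le> norm u'"
    using transit_between_low_points[OF te] unfolding C_def M_def by blast
  note adm = admissible_mono[OF D(2)]
  obtain R1 where R1: "admissible (mu \<epsilon> f) R1"
    using ex_admissible_mu[OF te \<epsilon>(1)] by blast
  define R where "R = max D R1"
  have R: "admissible (mu \<epsilon> f) R" "D \<le> R"
    using admissible_mono[OF R1, of R] by (auto simp: R_def)
  define a where "a n = (mu \<epsilon> f ^^ n) R" for n
  have aD: "D \<le> a n" for n
    using admissible_iter[OF R(1), of n] R(2) by (simp add: a_def)
  have mu_le: "mu \<epsilon> f r \<le> M r" if "D \<le> r" for r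
  proof -
    have "r < M r"
      using adm[OF that] by (simp add: admissible_def)
    then show ?thesis
      using mu_le_max_modulus[OF _ \<epsilon>(2), of f r] that D(1) by (simp add: M_def)
  qed
  have a_Suc: "a (Suc n) = mu \<epsilon> f (a n)" for n
    by (simp add: a_def)
  have a_add: "a (n + k) \<le> (M ^^ k) (a n)" for n k
  proof (induction k)
    case (Suc k)
    have "a (n + Suc k) \<le> M (a (n + k))"
      using mu_le[OF aD[of "n + k"]] by (simp add: a_Suc)
    also have "\<dots> \<le> M ((M ^^ k) (a n))"
      using Suc aD[of "n + k"] D(1) by (intro mono) auto
    finally show ?case
      by simp
  qed simp
  (* This is where irregularity enters. *)
  have lead: "\<exists>N0. \<forall>N\<ge>N0. 7 \<le> N \<and> a (n + N) \<le> (M ^^ (N - 7)) (a n)" for n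
  proof -
    \<comment> \<open>Irregularity, tested at a(n+7), gives j with a(n+7+j) < M^j(D) <= M^j(a(n)).
      This lag of seven persists since \<open>mu\<close> stays below M, and seven is the price of a
      leg.\<close>
    define r where "r = a (n + 7)"
    have rpos: "r > 0"
      using aD[of "n + 7"] D(1) by (simp add: r_def)
    have "\<not> (\<exists>r>0. \<forall>n\<ge>1. (mu \<epsilon> f ^^ n) r \<ge> (M ^^ n) D)"
      using eps_regular_iff[OF hol D(2)[unfolded M_def]] irreg by (simp add: M_def)
    then obtain j where j: "(mu \<epsilon> f ^^ j) r < (M ^^ j) D"
      using rpos not_le by blast
    have ar: "(mu \<epsilon> f ^^ i) r = a (n + 7 + i)" for i
      by (simp only: r_def a_def funpow_funpow add.commute)
    have "a (n + 7 + (j + i)) \<le> (M ^^ (j + i)) (a n)" for i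
    proof (induction i)
      case 0
      have "(M ^^ j) D \<le> (M ^^ j) (a n)"
        by (rule iter_mono[OF D(2) aD mono])
      then show ?case
        using j ar[of j] by simp
    next
      case (Suc i)
      have "a (n + 7 + (j + Suc i)) \<le> M (a (n + 7 + (j + i)))"
        using mu_le[OF aD[of "n + 7 + (j + i)"]] by (simp only: add_Suc_right a_Suc)
      also have "\<dots> \<le> M ((M ^^ (j + i)) (a n))"
        using Suc aD[of "n + 7 + (j + i)"] D(1) by (intro mono) auto
      finally show ?case
        by simp
    qed
    note ahead = this
    have "a (n + N) \<le> (M ^^ (N - 7)) (a n)" if N: "7 + j \<le> N" for N
    proof -
      obtain i where i: "N = 7 + j + i"
        using le_Suc_ex[OF N] by blast
      have "n + N = n + 7 + (j + i)" "N - 7 = j + i"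
        by (simp_all add: i)
      then show ?thesis
        using ahead[of i] by (simp only:)
    qed
    then show ?thesis
      by (intro exI[of _ "7 + j"]) auto
  qed
  \<comment> \<open>A state is a low point with the time of the visit; \<open>Inv\<close> is what
    the next leg needs.\<close>
  define Inv where "Inv = (\<lambda>(u, n). u \<in> low_points f \<and> (M ^^ 9) (a n) \<le> norm u)"
  define Trans where "Trans = (\<lambda>(u :: complex, n) (u' :: complex, n'). \<exists>N\<ge>1. n' = n + N \<and>
      annulus (norm u') \<subseteq> (f ^^ N) ` annulus (norm u) \<and>
      norm u' \<le> (M ^^ (N - 1)) (norm u) \<and> (M ^^ (N + 2)) (a n) \<le> norm u')"
  have "\<exists>s. \<forall>i. (Inv (s i) \<and> (i = 0 \<longrightarrow> snd (s i) = 0)) \<and> Trans (s i) (s (Suc i))"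
  proof (rule dependent_nat_choice)
    obtain u where "u \<in> low_points f" "(M ^^ 9) (a 0) \<le> norm u"
      using low_points_unbounded[OF te] by blast
    then show "\<exists>s. Inv s \<and> (0 = 0 \<longrightarrow> snd s = 0)"
      by (intro exI[of _ "(u, 0)"]) (simp add: Inv_def)
  next
    fix s and i :: nat
    assume "Inv s \<and> (i = 0 \<longrightarrow> snd s = 0)"
    moreover obtain u n where s: "s = (u, n)"
      by fastforce
    ultimately have u: "u \<in> low_points f" "(M ^^ 9) (a n) \<le> norm u"
      by (auto simp: Inv_def)
    obtain N0 where N0: "\<And>N. N \<ge> N0 \<Longrightarrow> 7 \<le> N \<and> a (n + N) \<le> (M ^^ (N - 7)) (a n)"
      using lead by blast
    obtain N u' where N: "N0 \<le> N" "u' \<in> low_points f" "annulus (norm u') \<subseteq> (f ^^ N) ` annulus (norm u)"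
      "norm u' \<le> (M ^^ (N - 1)) (norm u)" "(M ^^ (N + 2)) (a n) \<le> norm u'"
      using transit[OF aD u] by blast
    \<comment> \<open>The lag of seven turns M^9(a(n+N)) into at most M^(N+2)(a(n)), which restores
      the invariant.\<close>
    have "(M ^^ 9) (a (n + N)) \<le> (M ^^ 9) ((M ^^ (N - 7)) (a n))"
      using N0[OF N(1)] by (intro iter_mono[OF adm[OF aD] _ mono]) auto
    also have "\<dots> = (M ^^ (N + 2)) (a n)"
    proof -
      have "9 + (N - 7) = N + 2"
        using N0[OF N(1)] by simp
      then show ?thesis
        by (simp only: funpow_funpow)
    qed
    finally have "Inv (u', n + N)"
      using N by (simp add: Inv_def)
    moreover have "1 \<le> N"
      using N0[OF N(1)] by simp
    then have "Trans s (u', n + N)"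
      using N unfolding s Trans_def by auto
    ultimately show "\<exists>s'. (Inv s' \<and> (Suc i = 0 \<longrightarrow> snd s' = 0)) \<and> Trans s s'"
      by auto
  qed
  then obtain s where s: "\<And>i. Inv (s i)" "snd (s 0) = 0" "\<And>i. Trans (s i) (s (Suc i))"
    by metis
  define u where "u i = fst (s i)" for i
  define n where "n i = snd (s i)" for i
  have u_large: "(M ^^ 9) (a (n i)) \<le> norm (u i)" for i
    using s(1)[of i] by (simp add: Inv_def u_def n_def split_beta)
  have "\<forall>i. \<exists>N. 1 \<le> N \<and> n (Suc i) = n i + N \<and>
      annulus (norm (u (Suc i))) \<subseteq> (f ^^ N) ` annulus (norm (u i)) \<and>
      norm (u (Suc i)) \<le> (M ^^ (N - 1)) (norm (u i)) \<and> (M ^^ (N + 2)) (a (n i)) \<le> norm (u (Suc i))"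
    using s(3) by (simp add: Trans_def u_def n_def split_beta)
  then obtain N where N: "\<And>i. 1 \<le> N i" "\<And>i. n (Suc i) = n i + N i"
      "\<And>i. annulus (norm (u (Suc i))) \<subseteq> (f ^^ N i) ` annulus (norm (u i))"
      "\<And>i. norm (u (Suc i)) \<le> (M ^^ (N i - 1)) (norm (u i))"
      "\<And>i. (M ^^ (N i + 2)) (a (n i)) \<le> norm (u (Suc i))"
    by metis
  have n0: "n 0 = 0"
    using s(2) by (simp add: n_def)
  have uD: "D \<le> norm (u i)" for i
    using u_large[of i] admissible_iter[OF adm[OF aD[of "n i"]], of 9] aD[of "n i"] by linarith

  \<comment> \<open>These are the points following the first i legs. Pulling back through the
    coverings shows that they exist; nested compactness then yields one point \<zeta> following all
    legs.\<close>
  define E where "E i = {z \<in> annulus (norm (u 0)). \<forall>j\<le>i. (f ^^ n j) z \<in> annulus (norm (u j))}" for i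
  have "\<exists>z\<in>E i. (f ^^ n i) z = w" if "w \<in> annulus (norm (u i))" for w i
    using that
  proof (induction i arbitrary: w)
    case 0
    then show ?case
      by (auto simp: E_def n0)
  next
    case (Suc i)
    obtain w' where w': "w' \<in> annulus (norm (u i))" "w = (f ^^ N i) w'"
      using N(3)[of i] Suc.prems by blast
    obtain z where z: "z \<in> E i" "(f ^^ n i) z = w'"
      using Suc.IH[OF w'(1)] by blast
    have "(f ^^ n (Suc i)) z = w"
      using z(2) w'(2) N(2)[of i] by (simp add: add.commute[of "n i"] funpow_add)
    then show ?case
      using z(1) Suc.prems by (intro bexI[of _ z]) (auto simp: E_def le_Suc_eq)
  qed
  moreover have "u i \<in> annulus (norm (u i))" for i
    using C mult_right_mono[OF C, of "norm (u i)"]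
    unfolding closed_annulus_def C_def[symmetric] by (simp add: divide_le_eq mult.commute)
  ultimately have "E i \<noteq> {}" for i
    by blast
  moreover have "compact (E i)" for i
  proof -
    have "closed ((f ^^ n j) -` annulus (norm (u j)))" for j
      using entire_cont[OF holomorphic_funpow[OF hol, of "n j"]]
      by (intro continuous_closed_vimage) (auto simp: compact_imp_closed[OF compact_closed_annulus]
          continuous_on_eq_continuous_at)
    then have "closed (\<Inter>j\<le>i. (f ^^ n j) -` annulus (norm (u j)))"
      by auto
    moreover have "E i = annulus (norm (u 0)) \<inter> (\<Inter>j\<le>i. (f ^^ n j) -` annulus (norm (u j)))"
      by (auto simp: E_def)
    ultimately show ?thesis
      using compact_Int_closed[OF compact_closed_annulus] by metis
  qed
  moreover have "E j \<subseteq> E i" if "i \<le> j" for i j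
    using that by (auto simp: E_def)
  ultimately have "\<Inter> (range E) \<noteq> {}"
    by (intro compact_nest) auto
  then obtain \<zeta> where "\<And>i. \<zeta> \<in> E i"
    by auto
  then have \<zeta>: "(f ^^ n i) \<zeta> \<in> annulus (norm (u i))" for i
    by (auto simp: E_def)

  have n_ge: "i \<le> n i" for i
  proof (induction i)
    case (Suc i)
    then show ?case
      using N(1,2)[of i] by linarith
  qed simp
  (* A low value between two stations of the itinerary would force a low value at the second one. *)
  have orbit: "a j \<le> norm ((f ^^ j) \<zeta>)" for j
  proof (rule ccontr)
    assume "\<not> ?thesis"
    then have small: "norm ((f ^^ j) \<zeta>) \<le> a j"
      by simp
    define P where "P = (\<lambda>i. j < n i)"
    have "P (Suc j)"
      using n_ge[of "Suc j"] by (simp add: P_def)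
    then have "P (LEAST i. P i)"
      by (rule LeastI)
    moreover have "\<not> P 0"
      by (simp add: P_def n0)
    ultimately obtain i where i: "(LEAST i. P i) = Suc i" "P (Suc i)"
      by (metis not0_implies_Suc)
    then have "\<not> P i"
      by (metis lessI not_less_Least)
    then have "n i \<le> j"
      by (simp add: P_def)
    then obtain k where k: "j = n i + k"
      using le_Suc_ex[OF \<open>n i \<le> j\<close>] by blast
    have kN: "k < N i"
      using i(2) N(2)[of i] k by (simp add: P_def)
    have "(f ^^ n (Suc i)) \<zeta> = (f ^^ (N i - k)) ((f ^^ j) \<zeta>)"
    proof -
      have "N i - k + j = n (Suc i)"
        using kN k N(2)[of i] by simp
      then show ?thesis
        by (simp only: funpow_funpow)
    qed
    also have "norm \<dots> \<le> (M ^^ (N i - k)) (a j)"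
      unfolding M_def by (rule norm_funpow_le[OF hol adm[OF aD, unfolded M_def] small])
    also have "\<dots> \<le> (M ^^ (N i - k)) ((M ^^ k) (a (n i)))"
      unfolding k by (rule iter_mono[OF adm[OF aD] a_add mono])
    also have "\<dots> = (M ^^ N i) (a (n i))"
    proof -
      have "N i - k + k = N i"
        using kN by simp
      then show ?thesis
        by (simp only: funpow_funpow)
    qed
    finally have up: "norm ((f ^^ n (Suc i)) \<zeta>) \<le> (M ^^ N i) (a (n i))" .
    \<comment> \<open>Of the two spare iterates, one absorbs the width of the annulus and the other
      gives the contradiction.\<close>
    have "C * (M ^^ Suc (N i)) (a (n i)) \<le> (M ^^ (N i + 2)) (a (n i))"
      using D(3)[of "(M ^^ Suc (N i)) (a (n i))"] aD[of "n i"]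
        admissible_iter[OF adm[OF aD[of "n i"]], of "Suc (N i)"] by simp
    also have "\<dots> \<le> norm (u (Suc i))"
      by (rule N(5))
    also have "\<dots> \<le> C * norm ((f ^^ n (Suc i)) \<zeta>)"
      using \<zeta>[of "Suc i"] C by (simp add: closed_annulus_def C_def divide_le_eq mult.commute)
    finally have "(M ^^ Suc (N i)) (a (n i)) \<le> norm ((f ^^ n (Suc i)) \<zeta>)"
      using C by (meson less_le_trans mult_le_cancel_left_pos zero_less_one)
    then show False
      using up iter_less_Suc[OF adm[OF aD], of "N i" "n i"] by linarith
  qed
  have "\<zeta> \<in> quite_fast_escaping_eps \<epsilon> f"
  proof -
    have "(mu \<epsilon> f ^^ m) R \<le> norm ((f ^^ (m + 1)) \<zeta>)" for m
      using orbit[of "m + 1"] iter_less_Suc[OF R(1), of m] by (simp add: a_def)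
    then have "\<exists>l\<ge>1. \<forall>m\<ge>1. (mu \<epsilon> f ^^ m) R \<le> norm ((f ^^ (m + l)) \<zeta>)"
      by blast
    then show ?thesis
      unfolding quite_fast_escaping_eps_def using R(1) by blast
  qed
  moreover have "\<zeta> \<notin> fast_escaping f"
  proof
    assume "\<zeta> \<in> fast_escaping f"
    then obtain l where l: "\<And>m. m \<ge> 1 \<Longrightarrow> (M ^^ m) D \<le> norm ((f ^^ (m + l)) \<zeta>)"
      unfolding fast_escaping_eq[OF hol D(2)[unfolded M_def]] M_def by blast
    have deficit: "norm (u i) \<le> (M ^^ (n i - i)) (norm (u 0))" for i
    proof (induction i)
      case (Suc i)
      have "norm (u (Suc i)) \<le> (M ^^ (N i - 1)) (norm (u i))"
        by (rule N(4))
      also have "\<dots> \<le> (M ^^ (N i - 1)) ((M ^^ (n i - i)) (norm (u 0)))"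
        by (rule iter_mono[OF adm[OF uD] Suc mono])
      also have "\<dots> = (M ^^ (N i - 1 + (n i - i))) (norm (u 0))"
        by (simp add: funpow_add)
      also have "N i - 1 + (n i - i) = n (Suc i) - Suc i"
        using N(1,2)[of i] n_ge[of i] by simp
      finally show ?case .
    qed (simp add: n0)
    obtain q where q: "norm (u 0) \<le> (M ^^ q) D"
      using iter_reaches[OF D(2) mono lsc] by blast
    \<comment> \<open>After i legs i iterates are lost: \<open>l\<close> of them outweigh the shift,
      \<open>q\<close> the starting radius, one the annulus width, and one gives strictness.\<close>
    define i where "i = l + q + 2"
    have "norm ((f ^^ n i) \<zeta>) \<le> C * norm (u i)"
      using \<zeta>[of i] by (simp add: closed_annulus_def C_def)
    also have "\<dots> \<le> C * (M ^^ (n i - i)) (norm (u 0))"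
      using deficit[of i] C by (intro mult_left_mono) auto
    also have "\<dots> \<le> C * (M ^^ (n i - i)) ((M ^^ q) D)"
      using C by (intro mult_left_mono iter_mono[OF adm[OF uD] q mono]) auto
    also have "\<dots> \<le> (M ^^ Suc (n i - i + q)) D"
      using D(3)[of "(M ^^ (n i - i + q)) D"] admissible_iter[OF D(2), of "n i - i + q"]
      by (simp add: funpow_add)
    also have "\<dots> < (M ^^ Suc (Suc (n i - i + q))) D"
      by (rule iter_less_Suc[OF D(2)])
    also have "Suc (Suc (n i - i + q)) = n i - l"
      using n_ge[of i] by (simp add: i_def)
    also have "(M ^^ (n i - l)) D \<le> norm ((f ^^ n i) \<zeta>)"
      using l[of "n i - l"] n_ge[of i] by (simp add: i_def)
    finally show False
      by simp
  qed
  ultimately show ?thesis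
    by blast
qed

section \<open>Inclusions between the escaping sets\<close>

lemma fast_escaping_subset_quite_fast_escaping_eps:
  assumes te: "transcendental_entire f" and \<epsilon>: "0 < \<epsilon>" "\<epsilon> < 1"
  shows "fast_escaping f \<subseteq> quite_fast_escaping_eps \<epsilon> f"
proof
  fix z
  assume z: "z \<in> fast_escaping f"
  have hol: "f holomorphic_on UNIV"
    using te by (simp add: transcendental_entire_def)
  obtain R1 where R1: "admissible (mu \<epsilon> f) R1"
    using ex_admissible_mu[OF te \<epsilon>(1)] by blast
  obtain R2 where R2: "admissible (max_modulus f) R2"
    using ex_admissible_max_modulus[OF te] by blast
  define R where "R = max 1 (max R1 R2)"
  have R: "admissible (mu \<epsilon> f) R" "admissible (max_modulus f) R" "1 \<le> R"
    using admissible_mono[OF R1, of R] admissible_mono[OF R2, of R] by (auto simp: R_def)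
  obtain l where l: "l \<ge> 1" "\<And>n. n \<ge> 1 \<Longrightarrow> (max_modulus f ^^ n) R \<le> norm ((f ^^ (n + l)) z)"
    using z unfolding fast_escaping_eq[OF hol R(2)] by blast
  have "(mu \<epsilon> f ^^ n) R \<le> (max_modulus f ^^ n) R" for n
  proof (induction n)
    case (Suc n)
    define x where "x = (mu \<epsilon> f ^^ n) R"
    have x: "R \<le> x"
      using admissible_iter[OF R(1)] by (simp add: x_def)
    then have "x < max_modulus f x"
      using R(2) by (simp add: admissible_def)
    then have "mu \<epsilon> f x \<le> max_modulus f x"
      using x R(3) by (intro mu_le_max_modulus[OF _ \<epsilon>(2)]) simp
    also have "\<dots> \<le> max_modulus f ((max_modulus f ^^ n) R)"
      using Suc x R(3) by (intro max_modulus_mono[OF hol]) (auto simp: x_def)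
    finally show ?case
      by (simp add: x_def)
  qed simp
  then show "z \<in> quite_fast_escaping_eps \<epsilon> f"
    unfolding quite_fast_escaping_eps_eq[OF hol \<epsilon>(1) R(1)] using l by (auto intro: order_trans)
qed

text \<open>Iterating \<open>mu\<close> from R eventually passes r, so a shift by m steps compares
  the orbit with mu^n(r) and hence with M^n(R').\<close>

lemma quite_fast_escaping_eps_subset_fast_escaping:
  assumes te: "transcendental_entire f" and \<epsilon>: "0 < \<epsilon>" and reg: "eps_regular \<epsilon> f"
  shows "quite_fast_escaping_eps \<epsilon> f \<subseteq> fast_escaping f"
proof
  fix z
  assume z: "z \<in> quite_fast_escaping_eps \<epsilon> f"
  have hol: "f holomorphic_on UNIV"
    using te by (simp add: transcendental_entire_def)
  obtain R where R: "admissible (mu \<epsilon> f) R"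
    using ex_admissible_mu[OF te \<epsilon>] by blast
  obtain R' r where R': "admissible (max_modulus f) R'" and "r > 0"
    and r: "\<And>n. n \<ge> 1 \<Longrightarrow> (max_modulus f ^^ n) R' \<le> (mu \<epsilon> f ^^ n) r"
    using reg unfolding eps_regular_def by blast
  obtain l where l: "l \<ge> 1" "\<And>n. n \<ge> 1 \<Longrightarrow> (mu \<epsilon> f ^^ n) R \<le> norm ((f ^^ (n + l)) z)"
    using z unfolding quite_fast_escaping_eps_eq[OF hol \<epsilon> R] by blast
  obtain m where m: "r \<le> (mu \<epsilon> f ^^ m) R"
    using iter_reaches[OF R mu_mono[OF hol \<epsilon>] mu_lsc[OF hol \<epsilon>]] by blast
  \<comment> \<open>As r is not known to be admissible, positivity comes from comparison with
    M^n(R').\<close>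
  have pos: "0 < (mu \<epsilon> f ^^ n) r" for n
  proof (cases "n = 0")
    case False
    then show ?thesis
      using r[of n] admissible_iter[OF R', of n] R' by (simp add: admissible_def)
  qed (use \<open>r > 0\<close> in simp)
  have le: "(mu \<epsilon> f ^^ n) r \<le> (mu \<epsilon> f ^^ (n + m)) R" for n
  proof (induction n)
    case (Suc n)
    then show ?case
      using mu_mono[OF hol \<epsilon> pos[of n]] by simp
  qed (use m in simp)
  have "(max_modulus f ^^ n) R' \<le> norm ((f ^^ (n + (m + l))) z)" if "n \<ge> 1" for n
    using r[OF that] le[of n] l(2)[of "n + m"] that by (simp add: add.assoc)
  then show "z \<in> fast_escaping f"
    unfolding fast_escaping_eq[OF hol R'] using l(1) by (auto intro!: exI[of _ "m + l"])
qed

theorem theorem1p2: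
  fixes f :: "complex \<Rightarrow> complex" and \<epsilon> :: real
  assumes "transcendental_entire f"
    and "0 < \<epsilon>" and "\<epsilon> < 1"
  shows "(eps_regular \<epsilon> f \<longleftrightarrow> quite_fast_escaping_eps \<epsilon> f = fast_escaping f) \<and>
    (weakly_regular f \<longleftrightarrow> quite_fast_escaping f = fast_escaping f)"
proof -
  \<comment> \<open>Regularity is expressed by an inclusion because inclusions, unlike equalities,
    pass directly to the union over \<delta>.\<close>
  have reg_iff: "eps_regular \<delta> f \<longleftrightarrow> quite_fast_escaping_eps \<delta> f \<subseteq> fast_escaping f"
    if "0 < \<delta>" "\<delta> < 1" for \<delta>
    using slow_point_of_not_eps_regular[OF assms(1) that]
      quite_fast_escaping_eps_subset_fast_escaping[OF assms(1) that(1)] by blast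
  have sub: "fast_escaping f \<subseteq> quite_fast_escaping_eps \<delta> f" if "0 < \<delta>" "\<delta> < 1" for \<delta>
    using fast_escaping_subset_quite_fast_escaping_eps[OF assms(1) that] .
  have "eps_regular \<epsilon> f \<longleftrightarrow> quite_fast_escaping_eps \<epsilon> f = fast_escaping f"
    using reg_iff sub assms(2,3) by blast
  moreover have "fast_escaping f \<subseteq> quite_fast_escaping f"
    unfolding quite_fast_escaping_def using sub[OF assms(2,3)] assms(2,3) by fastforce
  then have "weakly_regular f \<longleftrightarrow> quite_fast_escaping f = fast_escaping f"
    using reg_iff unfolding weakly_regular_def quite_fast_escaping_def by fastforce
  ultimately show ?thesis
    by blast
qed

end
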